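(* (i) If $\mathcal{C}$ is an m.a.c. then any ultraproduct of $\mathcal{C}$ is generalised measurable. (ii) If $\mathcal{C}$ is an m.e.c. then any ultraproduct of $\mathcal{C}$ is ring-measurable, that is, generalised measurable with values in an ordered ring (an integral domain).
   Context: Definition of m.a.c. and m.e.c. Let $\mathcal{C}$ be a class of finite $L$-structures. For a tuple $\bar y$ of variables, $(\mathcal{C},\bar y)$ denotes the set of pairs $(M,\bar a)$ with $M\in\mathcal{C}$, $\bar a\in M^{|\bar y|}$. A partition $\Pi$ of $(\mathcal{C},\bar y)$ is $\emptyset$-definable if for each $\pi\in\Pi$ there is a parameter-free $L$-formula $\phi_\pi(\bar y)$ with $\phi_\pi(M^{|\bar y|})=\{\bar b\in M^{|\bar{y}|}:(M,\bar b)\in\pi\}$ for all $M\in\mathcal{C}$. $\mathcal{C}$ is a multidimensional asymptotic class (m.a.c.) if for every $L$-formula $\phi(\bar x;\bar y)$ there is a finite $\emptyset$-definable partition $\Pi$ of $(\mathcal{C},\bar y)$ and functions $h_\pi:\mathcal{C}\to\mathbb{R}^{\ge 0}$ ($\pi\in\Pi$) such that for each $\pi\in\Pi$ and every $\epsilon>0$ there is $Q\in\mathbb{N}$ such that for all $(M,\bar b)\in\pi$ with $|M|>Q$, $\big||\phi(M^{|\bar x|};\bar b)|-h_\pi(M)\big|\le\epsilon h_\pi(M)$. It is a multidimensional exact class (m.e.c.) if instead $|\phi(M^{|\bar x|};\bar b)|=h_\pi(M)$ for all $(M,\bar b)\in\pi$. An ultraproduct of $\mathcal{C}$ is an ultraproduct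 of the members of $\mathcal{C}$. Measuring semirings. An ordered semiring $S=(S,+,\cdot,0,1,<)$ satisfies: $(S,+,0)$ and $(S,\cdot,1)$ are commutative monoids; $\cdot$ distributes over $+$; $<$ is a total order with least element $0$; $x\le y\Rightarrow x+z\le y+z$; $x\le y\Rightarrow xz\le yz$; $0\cdot x=x\cdot 0=0$; $0<x,\ 0<y\Rightarrow 0<xy$; $0\ne1$. Write $a\sim b$ if $a\le b\le n\cdot a$ or $b\le a\le n\cdot b$ for some positive integer $n$ (where $n\cdot a=a+\dots+a$, $n$ times); $\sim$ is a convex equivalence relation, and $d:S\to D:=S/{\sim}$ is the quotient map. $S$ is a measuring semiring if in addition for all $x,y,z\in S$: if $x<y$ and $d(y)=d(z)$ then $x+z<y+z$. Generalised measurability. $\mathrm{Def}(M)$ is the collection of sets (in powers of $M$) definable in $M$ with parameters. For a measuring semiring $S$, an $L$-structure $M$ is $S$-measurable if there is $h:\mathrm{Def}(M)\to S$ such that: (1) $h(X)=|X|$ (i.e. $|X|\cdot 1$) for finite $X$; (2) $h(X\cup Y)=h(X)+h(Y)$ for disjoint $X,Y\in\mathrm{Def}(M)$; (3) for each family $\{\phi(M^{|\bar x|};\bar b):\bar b\in M^{|\bar y|}\}$ given by an $L$-formula $\phi(\bar x;\bar y)$, the set $F$ of values of $h$ on the family is finite, and for each $f\in F$ the set $\{\bar b:h(\phi(M^{|\bar x|};\bar b))=f\}$ is $\emptyset$-definable; (4) if $p:X\to Y$ is a definable function and $f\in S$ is such that $h(p^{-1}(a))=f$ for all $a\in Y$,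 then $h(X)=f\cdot h(Y)$. $M$ is generalised measurable if it is $S$-measurable for some measuring semiring $S$. $M$ is ring-measurable if there is a commutative unital ordered ring $S$ such that $M$ is $S^{\ge0}$-measurable, where $S^{\geq 0}$ is the semiring of non-negative elements of $S$. *)

theory Defs
  imports Complex_Main "HOL-Library.NList" "HOL-Library.Disjoint_Sets" "HOL-Algebra.Ring"
begin

declare nlistsE_length [simp del] nlists_appendE [rule del]  \<comment> \<open>they make automation diverge\<close>

section \<open>First-order logic\<close>

text \<open>The symbols of a language are carved out of the types by sets, since a HOL type cannot be
  empty. Constants are function symbols of arity 0.\<close>

record ('f, 'r) language =
  fun_syms :: "'f set"
  fun_arity :: "'f \<Rightarrow> nat"
  rel_syms :: "'r set"
  rel_arity :: "'r \<Rightarrow> nat"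

datatype 'f fo_term = Var nat | App 'f "'f fo_term list"

text \<open>Variables are de Bruijn indices; \<open>Exists\<close> binds index 0 of its body.\<close>

datatype ('f, 'r) formula =
    Falsum
  | Eq "'f fo_term" "'f fo_term"
  | Rel 'r "'f fo_term list"
  | Neg "('f, 'r) formula"
  | Conj "('f, 'r) formula" "('f, 'r) formula"
  | Exists "('f, 'r) formula"

fun term_of_lang :: "('f, 'r) language \<Rightarrow> nat \<Rightarrow> 'f fo_term \<Rightarrow> bool" where
  "term_of_lang L k (Var i) \<longleftrightarrow> i < k"
| "term_of_lang L k (App f ts) \<longleftrightarrow>
     f \<in> fun_syms L \<and> length ts = fun_arity L f \<and> (\<forall>t\<in>set ts. term_of_lang L k t)"

text \<open>\<open>formula_of_lang L k \<phi>\<close>: \<open>\<phi>\<close> is an \<open>L\<close>-formula whose free variables are among the \<open>k\<close> variables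
  with indices \<open>0, \<dots>, k - 1\<close>.\<close>

fun formula_of_lang :: "('f, 'r) language \<Rightarrow> nat \<Rightarrow> ('f, 'r) formula \<Rightarrow> bool" where
  "formula_of_lang L k Falsum \<longleftrightarrow> True"
| "formula_of_lang L k (Eq s t) \<longleftrightarrow> term_of_lang L k s \<and> term_of_lang L k t"
| "formula_of_lang L k (Rel r ts) \<longleftrightarrow>
     r \<in> rel_syms L \<and> length ts = rel_arity L r \<and> (\<forall>t\<in>set ts. term_of_lang L k t)"
| "formula_of_lang L k (Neg \<phi>) \<longleftrightarrow> formula_of_lang L k \<phi>"
| "formula_of_lang L k (Conj \<phi> \<psi>) \<longleftrightarrow> formula_of_lang L k \<phi> \<and> formula_of_lang L k \<psi>"
| "formula_of_lang L k (Exists \<phi>) \<longleftrightarrow> formula_of_lang L (Suc k) \<phi>"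

record ('f, 'r, 'm) fo_structure = "'m partial_object" +
  fun_interp :: "'f \<Rightarrow> 'm list \<Rightarrow> 'm"
  rel_interp :: "'r \<Rightarrow> 'm list \<Rightarrow> bool"

definition is_structure :: "('f, 'r) language \<Rightarrow> ('f, 'r, 'm) fo_structure \<Rightarrow> bool" where
  "is_structure L M \<longleftrightarrow> carrier M \<noteq> {} \<and>
     (\<forall>f\<in>fun_syms L. \<forall>xs\<in>nlists (fun_arity L f) (carrier M). fun_interp M f xs \<in> carrier M)"

fun eval_term :: "('f, 'r, 'm) fo_structure \<Rightarrow> 'm list \<Rightarrow> 'f fo_term \<Rightarrow> 'm" where
  "eval_term M e (Var i) = e ! i"
| "eval_term M e (App f ts) = fun_interp M f (map (eval_term M e) ts)"

fun sat :: "('f, 'r, 'm) fo_structure \<Rightarrow> 'm list \<Rightarrow> ('f, 'r) formula \<Rightarrow> bool" where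
  "sat M e Falsum \<longleftrightarrow> False"
| "sat M e (Eq s t) \<longleftrightarrow> eval_term M e s = eval_term M e t"
| "sat M e (Rel r ts) \<longleftrightarrow> rel_interp M r (map (eval_term M e) ts)"
| "sat M e (Neg \<phi>) \<longleftrightarrow> \<not> sat M e \<phi>"
| "sat M e (Conj \<phi> \<psi>) \<longleftrightarrow> sat M e \<phi> \<and> sat M e \<psi>"
| "sat M e (Exists \<phi>) \<longleftrightarrow> (\<exists>a\<in>carrier M. sat M (a # e) \<phi>)"

text \<open>In \<open>\<phi>(x; y)\<close> with \<open>|x| = n\<close> and \<open>|y| = m\<close>, the tuple \<open>x\<close> takes the indices \<open>0, \<dots>, n - 1\<close> and \<open>y\<close>
  the indices \<open>n, \<dots>, n + m - 1\<close>. The power \<open>M\<^sup>n\<close> is \<open>nlists n (carrier M)\<close>.\<close>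

definition solutions ::
    "('f, 'r, 'm) fo_structure \<Rightarrow> nat \<Rightarrow> ('f, 'r) formula \<Rightarrow> 'm list \<Rightarrow> 'm list set" where
  "solutions M n \<phi> b = {a \<in> nlists n (carrier M). sat M (a @ b) \<phi>}"

definition definable ::
    "('f, 'r) language \<Rightarrow> ('f, 'r, 'm) fo_structure \<Rightarrow> nat \<Rightarrow> 'm list set set" where
  "definable L M n =
     {solutions M n \<phi> b | m \<phi> b. formula_of_lang L (n + m) \<phi> \<and> b \<in> nlists m (carrier M)}"

definition Def :: "('f, 'r) language \<Rightarrow> ('f, 'r, 'm) fo_structure \<Rightarrow> 'm list set set" where
  "Def L M = (\<Union>n. definable L M n)"

definition definable0 ::
    "('f, 'r) language \<Rightarrow> ('f, 'r, 'm) fo_structure \<Rightarrow> nat \<Rightarrow> 'm list set set" where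
  "definable0 L M n = {solutions M n \<phi> [] | \<phi>. formula_of_lang L n \<phi>}"

section \<open>Multidimensional asymptotic and exact classes\<close>

definition finite_structures ::
    "('f, 'r) language \<Rightarrow> ('f, 'r, 'm) fo_structure set \<Rightarrow> bool" where
  "finite_structures L C \<longleftrightarrow> (\<forall>M\<in>C. is_structure L M \<and> finite (carrier M))"

definition pointed ::
    "('f, 'r, 'm) fo_structure set \<Rightarrow> nat \<Rightarrow> (('f, 'r, 'm) fo_structure \<times> 'm list) set" where
  "pointed C m = (SIGMA M:C. nlists m (carrier M))"

definition definable_partition ::
    "('f, 'r) language \<Rightarrow> ('f, 'r, 'm) fo_structure set \<Rightarrow> nat \<Rightarrow>
     (('f, 'r, 'm) fo_structure \<times> 'm list) set set \<Rightarrow> bool" where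
  "definable_partition L C m P \<longleftrightarrow> partition_on (pointed C m) P \<and>
     (\<forall>\<pi>\<in>P. \<exists>\<phi>. formula_of_lang L m \<phi> \<and>
        (\<forall>M\<in>C. solutions M m \<phi> [] = {b \<in> nlists m (carrier M). (M, b) \<in> \<pi>}))"

definition mac :: "('f, 'r) language \<Rightarrow> ('f, 'r, 'm) fo_structure set \<Rightarrow> bool" where
  "mac L C \<longleftrightarrow> finite_structures L C \<and>
     (\<forall>n m \<phi>. formula_of_lang L (n + m) \<phi> \<longrightarrow>
       (\<exists>P h. finite P \<and> definable_partition L C m P \<and>
         (\<forall>\<pi>\<in>P. \<forall>M\<in>C. 0 \<le> (h \<pi> M :: real)) \<and>
         (\<forall>\<pi>\<in>P. \<forall>\<epsilon>>0. \<exists>Q. \<forall>(M, b)\<in>\<pi>. card (carrier M) > Q \<longrightarrow>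
            \<bar>real (card (solutions M n \<phi> b)) - h \<pi> M\<bar> \<le> \<epsilon> * h \<pi> M)))"

definition mec :: "('f, 'r) language \<Rightarrow> ('f, 'r, 'm) fo_structure set \<Rightarrow> bool" where
  "mec L C \<longleftrightarrow> finite_structures L C \<and>
     (\<forall>n m \<phi>. formula_of_lang L (n + m) \<phi> \<longrightarrow>
       (\<exists>P h. finite P \<and> definable_partition L C m P \<and>
         (\<forall>\<pi>\<in>P. \<forall>M\<in>C. 0 \<le> (h \<pi> M :: real)) \<and>
         (\<forall>\<pi>\<in>P. \<forall>(M, b)\<in>\<pi>. real (card (solutions M n \<phi> b)) = h \<pi> M)))"

section \<open>Ultraproducts\<close>

definition ultrafilter :: "'i filter \<Rightarrow> bool" where
  "ultrafilter U \<longleftrightarrow> U \<noteq> bot \<and> (\<forall>P. eventually P U \<or> eventually (\<lambda>i. \<not> P i) U)"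

definition ultra_rel ::
    "'i filter \<Rightarrow> ('i \<Rightarrow> ('f, 'r, 'm) fo_structure) \<Rightarrow> (('i \<Rightarrow> 'm) \<times> ('i \<Rightarrow> 'm)) set" where
  "ultra_rel U M = {(x, y). x \<in> Pi UNIV (\<lambda>i. carrier (M i)) \<and> y \<in> Pi UNIV (\<lambda>i. carrier (M i)) \<and>
     eventually (\<lambda>i. x i = y i) U}"

text \<open>Symbols are interpreted through representatives; on tuples of the right arity the result does
  not depend on their choice.\<close>

definition ultraproduct ::
    "'i filter \<Rightarrow> ('i \<Rightarrow> ('f, 'r, 'm) fo_structure) \<Rightarrow> ('f, 'r, ('i \<Rightarrow> 'm) set) fo_structure" where
  "ultraproduct U M =
     \<lparr>carrier = Pi UNIV (\<lambda>i. carrier (M i)) // ultra_rel U M,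
      fun_interp = \<lambda>f Xs. ultra_rel U M `` {\<lambda>i. fun_interp (M i) f (map (\<lambda>X. (SOME x. x \<in> X) i) Xs)},
      rel_interp = \<lambda>r Xs. eventually (\<lambda>i. rel_interp (M i) r (map (\<lambda>X. (SOME x. x \<in> X) i) Xs)) U\<rparr>"

section \<open>Measuring semirings\<close>

record 'a ord_ring = "'a ring" +
  lt :: "'a \<Rightarrow> 'a \<Rightarrow> bool" (infix \<open>\<prec>\<index>\<close> 50)

definition le :: "('a, 'b) ord_ring_scheme \<Rightarrow> 'a \<Rightarrow> 'a \<Rightarrow> bool" (infix \<open>\<preceq>\<index>\<close> 50) where
  "x \<preceq>\<^bsub>S\<^esub> y \<longleftrightarrow> x \<prec>\<^bsub>S\<^esub> y \<or> x = y"

locale strictly_ordered =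
  fixes S (structure)
  assumes lt_irrefl: "x \<in> carrier S \<Longrightarrow> \<not> x \<prec> x"
    and lt_trans: "\<lbrakk>x \<in> carrier S; y \<in> carrier S; z \<in> carrier S; x \<prec> y; y \<prec> z\<rbrakk> \<Longrightarrow> x \<prec> z"
    and lt_total: "\<lbrakk>x \<in> carrier S; y \<in> carrier S\<rbrakk> \<Longrightarrow> x \<prec> y \<or> x = y \<or> y \<prec> x"

locale ordered_semiring = semiring S + comm_monoid S + strictly_ordered S for S (structure) +
  assumes zero_least: "x \<in> carrier S \<Longrightarrow> \<zero> \<preceq> x"
    and add_mono: "\<lbrakk>x \<in> carrier S; y \<in> carrier S; z \<in> carrier S; x \<preceq> y\<rbrakk> \<Longrightarrow> x \<oplus> z \<preceq> y \<oplus> z"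
    and mult_mono: "\<lbrakk>x \<in> carrier S; y \<in> carrier S; z \<in> carrier S; x \<preceq> y\<rbrakk> \<Longrightarrow> x \<otimes> z \<preceq> y \<otimes> z"
    and mult_pos: "\<lbrakk>x \<in> carrier S; y \<in> carrier S; \<zero> \<prec> x; \<zero> \<prec> y\<rbrakk> \<Longrightarrow> \<zero> \<prec> x \<otimes> y"
    and zero_neq_one: "\<zero> \<noteq> \<one>"

definition archimedean_equiv :: "('a, 'b) ord_ring_scheme \<Rightarrow> ('a \<times> 'a) set" where
  "archimedean_equiv S = {(a, b). a \<in> carrier S \<and> b \<in> carrier S \<and>
     (\<exists>n::nat. n > 0 \<and> (a \<preceq>\<^bsub>S\<^esub> b \<and> b \<preceq>\<^bsub>S\<^esub> [n] \<cdot>\<^bsub>S\<^esub> a \<or> b \<preceq>\<^bsub>S\<^esub> a \<and> a \<preceq>\<^bsub>S\<^esub> [n] \<cdot>\<^bsub>S\<^esub> b))}"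

definition dimension :: "('a, 'b) ord_ring_scheme \<Rightarrow> 'a \<Rightarrow> 'a set" where
  "dimension S x = archimedean_equiv S `` {x}"

locale measuring_semiring = ordered_semiring S for S (structure) +
  assumes add_strict_mono:
    "\<lbrakk>x \<in> carrier S; y \<in> carrier S; z \<in> carrier S; x \<prec> y; dimension S y = dimension S z\<rbrakk>
     \<Longrightarrow> x \<oplus> z \<prec> y \<oplus> z"

locale ordered_cring = cring S + strictly_ordered S for S (structure) +
  assumes add_mono: "\<lbrakk>x \<in> carrier S; y \<in> carrier S; z \<in> carrier S; x \<preceq> y\<rbrakk> \<Longrightarrow> x \<oplus> z \<preceq> y \<oplus> z"
    and mult_nonneg: "\<lbrakk>x \<in> carrier S; y \<in> carrier S; \<zero> \<preceq> x; \<zero> \<preceq> y\<rbrakk> \<Longrightarrow> \<zero> \<preceq> x \<otimes> y"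

definition nonneg :: "('a, 'b) ord_ring_scheme \<Rightarrow> ('a, 'b) ord_ring_scheme" where
  "nonneg S = S\<lparr>carrier := {x \<in> carrier S. \<zero>\<^bsub>S\<^esub> \<preceq>\<^bsub>S\<^esub> x}\<rparr>"

section \<open>Generalised measurability\<close>

definition is_measure ::
    "('f, 'r) language \<Rightarrow> ('a, 'b) ord_ring_scheme \<Rightarrow> ('f, 'r, 'm) fo_structure \<Rightarrow>
     ('m list set \<Rightarrow> 'a) \<Rightarrow> bool" where
  "is_measure L S M h \<longleftrightarrow>
     h \<in> Def L M \<rightarrow> carrier S \<and>
     (\<forall>X\<in>Def L M. finite X \<longrightarrow> h X = [card X] \<cdot>\<^bsub>S\<^esub> \<one>\<^bsub>S\<^esub>) \<and>
     (\<forall>n. \<forall>X\<in>definable L M n. \<forall>Y\<in>definable L M n. X \<inter> Y = {} \<longrightarrow> h (X \<union> Y) = h X \<oplus>\<^bsub>S\<^esub> h Y) \<and>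
     (\<forall>n m \<phi>. formula_of_lang L (n + m) \<phi> \<longrightarrow>
        (let F = (\<lambda>b. h (solutions M n \<phi> b)) ` nlists m (carrier M)
         in finite F \<and>
            (\<forall>f\<in>F. {b \<in> nlists m (carrier M). h (solutions M n \<phi> b) = f} \<in> definable0 L M m))) \<and>
     (\<forall>n k. \<forall>X\<in>definable L M n. \<forall>Y\<in>definable L M k. \<forall>p\<in>X \<rightarrow> Y. \<forall>f\<in>carrier S.
        (\<lambda>x. x @ p x) ` X \<in> definable L M (n + k) \<and> (\<forall>a\<in>Y. h {x \<in> X. p x = a} = f) \<longrightarrow>
        h X = f \<otimes>\<^bsub>S\<^esub> h Y)"

definition measurable_in ::
    "('f, 'r) language \<Rightarrow> ('a, 'b) ord_ring_scheme \<Rightarrow> ('f, 'r, 'm) fo_structure \<Rightarrow> bool" where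
  "measurable_in L S M \<longleftrightarrow> measuring_semiring S \<and> (\<exists>h. is_measure L S M h)"

text \<open>HOL cannot quantify existentially over the type of values of a measure, so a single, sufficiently
  large type is used: (semi)ring expressions in the definable sets. This is no restriction, because a
  (semi)ring of values over any type can be cut down to the sub(semi)ring generated by the values of
  the measure, whose elements are denoted by such expressions; see \<open>generalised_measurableI\<close> and
  \<open>ring_measurableI\<close> below.\<close>

datatype 'x ring_expr =
    Zero | One | Gen 'x | Plus "'x ring_expr" "'x ring_expr" | Times "'x ring_expr" "'x ring_expr"
  | Minus "'x ring_expr"

definition generalised_measurable ::
    "('f, 'r) language \<Rightarrow> ('f, 'r, 'm) fo_structure \<Rightarrow> bool" where
  "generalised_measurable L M \<longleftrightarrow> (\<exists>S :: 'm list set ring_expr ord_ring. measurable_in L S M)"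

definition ring_measurable ::
    "('f, 'r) language \<Rightarrow> ('f, 'r, 'm) fo_structure \<Rightarrow> bool" where
  "ring_measurable L M \<longleftrightarrow>
     (\<exists>S :: 'm list set ring_expr ord_ring. ordered_cring S \<and> measurable_in L (nonneg S) M)"

subsection \<open>Independence of the type of values\<close>

locale ord_embedding =
  fixes T :: "('a, 'b) ord_ring_scheme" and S :: "('c, 'd) ord_ring_scheme" and k :: "'a \<Rightarrow> 'c"
  assumes closed: "\<zero>\<^bsub>T\<^esub> \<in> carrier T" "\<one>\<^bsub>T\<^esub> \<in> carrier T"
      "\<lbrakk>x \<in> carrier T; y \<in> carrier T\<rbrakk> \<Longrightarrow> x \<oplus>\<^bsub>T\<^esub> y \<in> carrier T"
      "\<lbrakk>x \<in> carrier T; y \<in> carrier T\<rbrakk> \<Longrightarrow> x \<otimes>\<^bsub>T\<^esub> y \<in> carrier T"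
    and into: "x \<in> carrier T \<Longrightarrow> k x \<in> carrier S"
    and inj: "\<lbrakk>x \<in> carrier T; y \<in> carrier T\<rbrakk> \<Longrightarrow> x = y \<longleftrightarrow> k x = k y"
    and hom: "k \<zero>\<^bsub>T\<^esub> = \<zero>\<^bsub>S\<^esub>" "k \<one>\<^bsub>T\<^esub> = \<one>\<^bsub>S\<^esub>"
      "\<lbrakk>x \<in> carrier T; y \<in> carrier T\<rbrakk> \<Longrightarrow> k (x \<oplus>\<^bsub>T\<^esub> y) = k x \<oplus>\<^bsub>S\<^esub> k y"
      "\<lbrakk>x \<in> carrier T; y \<in> carrier T\<rbrakk> \<Longrightarrow> k (x \<otimes>\<^bsub>T\<^esub> y) = k x \<otimes>\<^bsub>S\<^esub> k y"
    and lt_iff: "\<lbrakk>x \<in> carrier T; y \<in> carrier T\<rbrakk> \<Longrightarrow> x \<prec>\<^bsub>T\<^esub> y \<longleftrightarrow> k x \<prec>\<^bsub>S\<^esub> k y"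
begin

lemma le_iff: "\<lbrakk>x \<in> carrier T; y \<in> carrier T\<rbrakk> \<Longrightarrow> x \<preceq>\<^bsub>T\<^esub> y \<longleftrightarrow> k x \<preceq>\<^bsub>S\<^esub> k y"
  by (simp add: le_def lt_iff inj)

lemma add_pow_closed: "x \<in> carrier T \<Longrightarrow> [(n::nat)] \<cdot>\<^bsub>T\<^esub> x \<in> carrier T"
  by (induction n) (simp_all add: add_pow_def nat_pow_def closed)

lemma add_pow_hom: "x \<in> carrier T \<Longrightarrow> k ([(n::nat)] \<cdot>\<^bsub>T\<^esub> x) = [n] \<cdot>\<^bsub>S\<^esub> k x"
proof (induction n)
  case 0
  then show ?case by (simp add: add_pow_def nat_pow_def hom)
next
  case (Suc n)
  have "[Suc n] \<cdot>\<^bsub>T\<^esub> x = ([n] \<cdot>\<^bsub>T\<^esub> x) \<oplus>\<^bsub>T\<^esub> x" "[Suc n] \<cdot>\<^bsub>S\<^esub> k x = ([n] \<cdot>\<^bsub>S\<^esub> k x) \<oplus>\<^bsub>S\<^esub> k x"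
    by (simp_all add: add_pow_def nat_pow_def)
  with Suc show ?case by (simp add: hom add_pow_closed)
qed

lemma archimedean_equiv_iff:
  "\<lbrakk>x \<in> carrier T; y \<in> carrier T\<rbrakk> \<Longrightarrow>
   (x, y) \<in> archimedean_equiv T \<longleftrightarrow> (k x, k y) \<in> archimedean_equiv S"
  by (simp add: archimedean_equiv_def le_iff add_pow_closed add_pow_hom into)

lemma strictly_ordered: "strictly_ordered S \<Longrightarrow> strictly_ordered T"
proof -
  assume "strictly_ordered S"
  then interpret S: strictly_ordered S .
  show ?thesis
  proof
    fix x assume "x \<in> carrier T"
    then show "\<not> x \<prec>\<^bsub>T\<^esub> x" by (simp add: lt_iff into S.lt_irrefl)
  next
    fix x y z assume "x \<in> carrier T" "y \<in> carrier T" "z \<in> carrier T" "x \<prec>\<^bsub>T\<^esub> y" "y \<prec>\<^bsub>T\<^esub> z"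
    then show "x \<prec>\<^bsub>T\<^esub> z" using S.lt_trans[of "k x" "k y" "k z"] by (simp add: lt_iff into)
  next
    fix x y assume "x \<in> carrier T" "y \<in> carrier T"
    then show "x \<prec>\<^bsub>T\<^esub> y \<or> x = y \<or> y \<prec>\<^bsub>T\<^esub> x"
      using S.lt_total[of "k x" "k y"] by (simp add: lt_iff inj into)
  qed
qed

lemma semiring: "semiring S \<Longrightarrow> semiring T"
proof -
  assume "semiring S"
  then interpret S: semiring S .
  show ?thesis
    by (unfold_locales; simp add: inj closed hom into S.add.m_ac S.m_assoc S.l_distr S.r_distr)
qed

end

lemma (in ordered_semiring) le_refl: "x \<preceq> x"
  by (simp add: le_def)

lemma (in ordered_semiring) le_trans:
  "\<lbrakk>x \<in> carrier S; y \<in> carrier S; z \<in> carrier S; x \<preceq> y; y \<preceq> z\<rbrakk> \<Longrightarrow> x \<preceq> z"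
  unfolding le_def using lt_trans[of x y z] by metis

lemma (in ordered_semiring) archimedean_equiv_refl:
  assumes "x \<in> carrier S" shows "(x, x) \<in> archimedean_equiv S"
proof -
  have "[(1::nat)] \<cdot> x = x" using assms by (simp add: add_pow_def nat_pow_def)
  then have "x \<preceq> x \<and> x \<preceq> [(1::nat)] \<cdot> x" by (simp only: le_refl simp_thms)
  then show ?thesis using assms unfolding archimedean_equiv_def by blast
qed

lemma (in ordered_semiring) add_pow_mono:
  assumes "x \<in> carrier S" "y \<in> carrier S" "x \<preceq> y"
  shows "[(n::nat)] \<cdot> x \<preceq> [n] \<cdot> y"
proof (induction n)
  case (Suc n)
  have "[n] \<cdot> x \<oplus> x \<preceq> [n] \<cdot> y \<oplus> x" using add_mono Suc assms by simp
  moreover have "[n] \<cdot> y \<oplus> x \<preceq> [n] \<cdot> y \<oplus> y"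
    using add_mono[of x y "[n] \<cdot> y"] assms by (simp add: a_comm)
  ultimately have "[n] \<cdot> x \<oplus> x \<preceq> [n] \<cdot> y \<oplus> y"
    using le_trans[of "[n] \<cdot> x \<oplus> x" "[n] \<cdot> y \<oplus> x" "[n] \<cdot> y \<oplus> y"] assms by simp
  then show ?case using assms by simp
qed (simp add: le_def)

lemma (in ordered_semiring) le_add:
  assumes "x \<in> carrier S" "y \<in> carrier S" shows "x \<preceq> y \<oplus> x"
  using add_mono[of \<zero> y x] zero_least assms by simp

lemma (in ordered_semiring) add_pow_mono_num:
  assumes "x \<in> carrier S" "m \<le> n"
  shows "[(m::nat)] \<cdot> x \<preceq> [n] \<cdot> x"
proof -
  have "[n] \<cdot> x = [(n - m)] \<cdot> x \<oplus> [m] \<cdot> x" using assms by (simp add: add.nat_pow_mult)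
  then show ?thesis using le_add assms by simp
qed

text \<open>\<open>a \<sim> b\<close> iff each is at most a positive multiple of the other.\<close>

lemma (in ordered_semiring) archimedean_equiv_alt:
  assumes x: "x \<in> carrier S" and y: "y \<in> carrier S"
  shows "(x, y) \<in> archimedean_equiv S \<longleftrightarrow>
    (\<exists>n::nat. n > 0 \<and> y \<preceq> [n] \<cdot> x) \<and> (\<exists>n::nat. n > 0 \<and> x \<preceq> [n] \<cdot> y)"
    (is "?l \<longleftrightarrow> ?r")
proof
  have one: "[(1::nat)] \<cdot> z = z" if "z \<in> carrier S" for z
    using that by (simp add: add_pow_def nat_pow_def)
  assume ?l
  then obtain n :: nat where "n > 0" "x \<preceq> y \<and> y \<preceq> [n] \<cdot> x \<or> y \<preceq> x \<and> x \<preceq> [n] \<cdot> y"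
    unfolding archimedean_equiv_def by blast
  moreover from this have "x \<preceq> [(1::nat)] \<cdot> y \<or> y \<preceq> [(1::nat)] \<cdot> x" "(1::nat) > 0"
    using one[OF x] one[OF y] by auto
  ultimately show ?r
    using one[OF x] one[OF y] by metis
next
  assume ?r
  then obtain m n :: nat where "m > 0" "n > 0" "y \<preceq> [m] \<cdot> x" "x \<preceq> [n] \<cdot> y" by blast
  then show ?l
    using lt_total[OF x y] x y unfolding archimedean_equiv_def le_def by blast
qed

lemma (in ordered_semiring) archimedean_equiv_trans:
  assumes x: "x \<in> carrier S" and y: "y \<in> carrier S" and z: "z \<in> carrier S"
    and "(x, y) \<in> archimedean_equiv S" "(y, z) \<in> archimedean_equiv S"
  shows "(x, z) \<in> archimedean_equiv S"
proof -
  have *: "\<exists>n::nat. n > 0 \<and> c \<preceq> [n] \<cdot> a"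
    if abc: "a \<in> carrier S" "b \<in> carrier S" "c \<in> carrier S" and
      ex: "\<exists>n::nat. n > 0 \<and> b \<preceq> [n] \<cdot> a" "\<exists>n::nat. n > 0 \<and> c \<preceq> [n] \<cdot> b" for a b c
  proof -
    obtain m n :: nat where mn: "m > 0" "n > 0" and ba: "b \<preceq> [m] \<cdot> a" and cb: "c \<preceq> [n] \<cdot> b"
      using ex by blast
    have "c \<preceq> [n] \<cdot> ([m] \<cdot> a)"
      by (rule le_trans[OF _ _ _ cb add_pow_mono[OF _ _ ba]]) (simp_all add: abc)
    then have "c \<preceq> [(m * n)] \<cdot> a" by (simp only: add.nat_pow_pow[OF abc(1)])
    then show ?thesis using mn by (intro exI[of _ "m * n"]) simp
  qed
  show ?thesis
    using *[OF x y z] *[OF z y x] assms(4,5)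
    unfolding archimedean_equiv_alt[OF x y] archimedean_equiv_alt[OF y z] archimedean_equiv_alt[OF x z]
    by blast
qed

lemma (in ordered_semiring) archimedean_equiv_sym:
  "(x, y) \<in> archimedean_equiv S \<Longrightarrow> (y, x) \<in> archimedean_equiv S"
  unfolding archimedean_equiv_def by auto

lemma (in ordered_semiring) dimension_eq_iff:
  assumes x: "x \<in> carrier S" and y: "y \<in> carrier S"
  shows "dimension S x = dimension S y \<longleftrightarrow> (x, y) \<in> archimedean_equiv S"
proof
  assume "dimension S x = dimension S y"
  then show "(x, y) \<in> archimedean_equiv S"
    using archimedean_equiv_refl[OF y] unfolding dimension_def by auto
next
  assume xy: "(x, y) \<in> archimedean_equiv S"
  have "z \<in> carrier S" if "(w, z) \<in> archimedean_equiv S" for w z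
    using that by (simp add: archimedean_equiv_def)
  then have "(x, z) \<in> archimedean_equiv S \<longleftrightarrow> (y, z) \<in> archimedean_equiv S" for z
    using archimedean_equiv_trans[OF x y, of z] archimedean_equiv_trans[OF y x, of z]
      archimedean_equiv_sym[OF xy] xy by auto
  then show "dimension S x = dimension S y"
    unfolding dimension_def by auto
qed

context ord_embedding
begin

lemma measuring_semiring:
  assumes "measuring_semiring S"
  shows "measuring_semiring T"
proof -
  interpret S: measuring_semiring S by fact
  interpret T: semiring T by (rule semiring) unfold_locales
  interpret T: strictly_ordered T by (rule strictly_ordered) unfold_locales
  have os: "ordered_semiring T"
  proof unfold_locales
    fix x y assume "x \<in> carrier T" "y \<in> carrier T"
    then show "x \<otimes>\<^bsub>T\<^esub> y = y \<otimes>\<^bsub>T\<^esub> x" by (simp add: inj closed hom into S.m_comm)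
  next
    fix x assume "x \<in> carrier T"
    then show "\<zero>\<^bsub>T\<^esub> \<preceq>\<^bsub>T\<^esub> x" by (simp add: le_iff closed hom into S.zero_least)
  next
    fix x y z assume "x \<in> carrier T" "y \<in> carrier T" "z \<in> carrier T" "x \<preceq>\<^bsub>T\<^esub> y"
    then show "x \<oplus>\<^bsub>T\<^esub> z \<preceq>\<^bsub>T\<^esub> y \<oplus>\<^bsub>T\<^esub> z" "x \<otimes>\<^bsub>T\<^esub> z \<preceq>\<^bsub>T\<^esub> y \<otimes>\<^bsub>T\<^esub> z"
      by (simp_all add: le_iff closed hom into S.add_mono S.mult_mono)
  next
    fix x y assume "x \<in> carrier T" "y \<in> carrier T" "\<zero>\<^bsub>T\<^esub> \<prec>\<^bsub>T\<^esub> x" "\<zero>\<^bsub>T\<^esub> \<prec>\<^bsub>T\<^esub> y"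
    then show "\<zero>\<^bsub>T\<^esub> \<prec>\<^bsub>T\<^esub> x \<otimes>\<^bsub>T\<^esub> y" by (simp add: lt_iff closed hom into S.mult_pos)
  next
    show "\<zero>\<^bsub>T\<^esub> \<noteq> \<one>\<^bsub>T\<^esub>" by (simp add: inj closed hom S.zero_neq_one)
  qed
  then interpret T: ordered_semiring T .
  show ?thesis
  proof unfold_locales
    fix x y z
    assume *: "x \<in> carrier T" "y \<in> carrier T" "z \<in> carrier T" "x \<prec>\<^bsub>T\<^esub> y"
      "dimension T y = dimension T z"
    then have "dimension S (k y) = dimension S (k z)"
      by (simp add: T.dimension_eq_iff S.dimension_eq_iff archimedean_equiv_iff into)
    then show "x \<oplus>\<^bsub>T\<^esub> z \<prec>\<^bsub>T\<^esub> y \<oplus>\<^bsub>T\<^esub> z"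
      using * by (simp add: lt_iff closed hom into S.add_strict_mono)
  qed
qed

end

lemma fibre_definable:
  assumes X: "X \<subseteq> nlists n (carrier M)" and Y: "Y \<subseteq> nlists k (carrier M)" and p: "p \<in> X \<rightarrow> Y"
    and graph: "(\<lambda>x. x @ p x) ` X \<in> definable L M (n + k)" and a: "a \<in> Y"
  shows "{x \<in> X. p x = a} \<in> definable L M n"
proof -
  obtain m \<gamma> c where \<gamma>: "formula_of_lang L (n + k + m) \<gamma>" and c: "c \<in> nlists m (carrier M)"
    and eq: "(\<lambda>x. x @ p x) ` X = solutions M (n + k) \<gamma> c"
    using graph unfolding definable_def mem_Collect_eq by (elim exE conjE) (rule that)
  have ak: "a \<in> nlists k (carrier M)" using a Y by (rule rev_subsetD)
  then have ac: "a @ c \<in> nlists (k + m) (carrier M)"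
    using c by (rule nlists_appendI)
  have "x \<in> X \<and> p x = a \<longleftrightarrow> x \<in> nlists n (carrier M) \<and> sat M (x @ a @ c) \<gamma>" for x
  proof
    assume *: "x \<in> X \<and> p x = a"
    then have "x @ a \<in> solutions M (n + k) \<gamma> c" using eq by blast
    then have "sat M (x @ a @ c) \<gamma>" unfolding solutions_def mem_Collect_eq append_assoc by blast
    then show "x \<in> nlists n (carrier M) \<and> sat M (x @ a @ c) \<gamma>"
      using * X by blast
  next
    assume *: "x \<in> nlists n (carrier M) \<and> sat M (x @ a @ c) \<gamma>"
    then have "x @ a \<in> solutions M (n + k) \<gamma> c"
      using nlists_appendI[OF _ ak, of x n] unfolding solutions_def mem_Collect_eq append_assoc by blast
    then obtain x' where x': "x' \<in> X" "x @ a = x' @ p x'" unfolding eq[symmetric] by blast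
    then have "x' \<in> nlists n (carrier M)" using X by blast
    then have "length x = length x'"
      using * unfolding nlists_def mem_Collect_eq by (elim conjE) (rule trans[OF _ sym])
    with x' show "x \<in> X \<and> p x = a" by (metis append_eq_append_conv)
  qed
  then have "{x \<in> X. p x = a} = solutions M n \<gamma> (a @ c)"
    unfolding solutions_def by auto
  moreover have "formula_of_lang L (n + (k + m)) \<gamma>" using \<gamma> by (simp add: add.assoc)
  ultimately show ?thesis
    using ac unfolding definable_def by blast
qed

lemma definable_subset: "X \<in> definable L M n \<Longrightarrow> X \<subseteq> nlists n (carrier M)"
  by (auto simp: definable_def solutions_def)

lemma (in ord_embedding) is_measure:
  assumes "semiring S" and h0: "is_measure L S M h0"
    and h: "\<And>X. h X \<in> carrier T" and kh: "\<And>X. h0 X \<in> carrier S \<Longrightarrow> k (h X) = h0 X"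
  shows "is_measure L T M h"
proof -
  interpret S: semiring S by fact
  note h0' = h0[unfolded is_measure_def Let_def]
  note h0_range = h0'[THEN conjunct1, THEN funcset_mem]
    and h0_card = h0'[THEN conjunct2, THEN conjunct1, rule_format]
    and h0_union = h0'[THEN conjunct2, THEN conjunct2, THEN conjunct1, rule_format]
    and h0_family = h0'[THEN conjunct2, THEN conjunct2, THEN conjunct2, THEN conjunct1, rule_format]
    and h0_fibre = h0'[THEN conjunct2, THEN conjunct2, THEN conjunct2, THEN conjunct2, THEN spec,
      THEN spec, THEN bspec, THEN bspec, THEN bspec, THEN bspec, THEN mp]
  have Def: "h0 X \<in> carrier S" if "X \<in> definable L M n" for X n
    using that by (intro h0_range) (auto simp: Def_def)
  have kh': "k (h X) = h0 X" if "X \<in> definable L M n" for X n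
    using kh Def that by blast
  have sol: "solutions M n \<phi> b \<in> definable L M n"
    if "formula_of_lang L (n + m) \<phi>" "b \<in> nlists m (carrier M)" for n m \<phi> b
    using that unfolding definable_def by blast
  have m1: "h X = [card X] \<cdot>\<^bsub>T\<^esub> \<one>\<^bsub>T\<^esub>" if "X \<in> Def L M" "finite X" for X
  proof -
    obtain n where X: "X \<in> definable L M n" using \<open>X \<in> Def L M\<close> unfolding Def_def by blast
    have "h0 X = [card X] \<cdot>\<^bsub>S\<^esub> \<one>\<^bsub>S\<^esub>" using that by (rule h0_card)
    then show ?thesis by (simp add: inj h add_pow_closed closed kh'[OF X] add_pow_hom hom)
  qed
  have m2: "h (X \<union> Y) = h X \<oplus>\<^bsub>T\<^esub> h Y"
    if X: "X \<in> definable L M n" and Y: "Y \<in> definable L M n" and "X \<inter> Y = {}" for n X Y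
  proof -
    have u: "h0 (X \<union> Y) = h0 X \<oplus>\<^bsub>S\<^esub> h0 Y" using that by (rule h0_union)
    then have "k (h (X \<union> Y)) = h0 X \<oplus>\<^bsub>S\<^esub> h0 Y" using kh Def[OF X] Def[OF Y] by simp
    then show ?thesis by (simp add: inj h closed hom kh'[OF X] kh'[OF Y])
  qed
  have m3: "finite ((\<lambda>b. h (solutions M n \<phi> b)) ` nlists m (carrier M)) \<and>
      (\<forall>f\<in>(\<lambda>b. h (solutions M n \<phi> b)) ` nlists m (carrier M).
         {b \<in> nlists m (carrier M). h (solutions M n \<phi> b) = f} \<in> definable0 L M m)"
    if \<phi>: "formula_of_lang L (n + m) \<phi>" for n m \<phi>
  proof -
    let ?B = "nlists m (carrier M)"
    have F: "finite ((\<lambda>b. h0 (solutions M n \<phi> b)) ` ?B)"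
      and d: "\<And>b. b \<in> ?B \<Longrightarrow>
        {b' \<in> ?B. h0 (solutions M n \<phi> b') = h0 (solutions M n \<phi> b)} \<in> definable0 L M m"
      using h0_family[OF \<phi>] by blast+
    have khb: "k (h (solutions M n \<phi> b)) = h0 (solutions M n \<phi> b)" if "b \<in> ?B" for b
      using kh' sol[OF \<phi> that] by blast
    have "k ` ((\<lambda>b. h (solutions M n \<phi> b)) ` ?B) = (\<lambda>b. h0 (solutions M n \<phi> b)) ` ?B"
      unfolding image_image using khb by (intro image_cong) auto
    moreover have "inj_on k ((\<lambda>b. h (solutions M n \<phi> b)) ` ?B)"
    proof (rule inj_onI)
      fix x y
      assume "x \<in> (\<lambda>b. h (solutions M n \<phi> b)) ` ?B" "y \<in> (\<lambda>b. h (solutions M n \<phi> b)) ` ?B"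
        and "k x = k y"
      moreover from this have "x \<in> carrier T" "y \<in> carrier T" using h by blast+
      ultimately show "x = y" using inj by blast
    qed
    ultimately have "finite ((\<lambda>b. h (solutions M n \<phi> b)) ` ?B)"
      using F by (metis finite_imageD)
    moreover have "{b' \<in> ?B. h (solutions M n \<phi> b') = h (solutions M n \<phi> b)} \<in> definable0 L M m"
      if b: "b \<in> ?B" for b
    proof -
      have "h (solutions M n \<phi> b') = h (solutions M n \<phi> b) \<longleftrightarrow>
          h0 (solutions M n \<phi> b') = h0 (solutions M n \<phi> b)" if "b' \<in> ?B" for b'
        using inj[OF h h, of "solutions M n \<phi> b'" "solutions M n \<phi> b"]
        unfolding khb[OF b] khb[OF that] .
      then have "{b' \<in> ?B. h (solutions M n \<phi> b') = h (solutions M n \<phi> b)} =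
          {b' \<in> ?B. h0 (solutions M n \<phi> b') = h0 (solutions M n \<phi> b)}"
        by blast
      with d[OF b] show ?thesis by (rule ssubst[rotated])
    qed
    ultimately show ?thesis by blast
  qed
  have m4: "h X = f \<otimes>\<^bsub>T\<^esub> h Y"
    if X: "X \<in> definable L M n" and Y: "Y \<in> definable L M j" and p: "p \<in> X \<rightarrow> Y"
      and f: "f \<in> carrier T" and graph: "(\<lambda>x. x @ p x) ` X \<in> definable L M (n + j)"
      and fib: "\<forall>a\<in>Y. h {x \<in> X. p x = a} = f" for n j X Y p f
  proof -
    have "h0 {x \<in> X. p x = a} = k f" if "a \<in> Y" for a
      using kh'[OF fibre_definable[OF definable_subset[OF X] definable_subset[OF Y] p graph that]]
        fib[rule_format, OF that] by simp
    then have "h0 X = k f \<otimes>\<^bsub>S\<^esub> h0 Y"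
      using h0_fibre[OF X Y p into[OF f]] graph by blast
    then show ?thesis by (simp add: inj h f closed hom kh'[OF X] kh'[OF Y])
  qed
  show ?thesis
    unfolding is_measure_def Let_def
  proof (intro conjI allI ballI impI)
    show "h \<in> Def L M \<rightarrow> carrier T" using h by (rule funcsetI)
  next
    fix X assume "X \<in> Def L M" "finite X"
    then show "h X = [card X] \<cdot>\<^bsub>T\<^esub> \<one>\<^bsub>T\<^esub>" by (rule m1)
  next
    fix n X Y assume "X \<in> definable L M n" "Y \<in> definable L M n" "X \<inter> Y = {}"
    then show "h (X \<union> Y) = h X \<oplus>\<^bsub>T\<^esub> h Y" by (rule m2)
  next
    fix n m \<phi> assume "formula_of_lang L (n + m) \<phi>"
    then show "finite ((\<lambda>b. h (solutions M n \<phi> b)) ` nlists m (carrier M))"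
      by (rule m3[THEN conjunct1])
  next
    fix n m \<phi> f assume "formula_of_lang L (n + m) \<phi>"
      "f \<in> (\<lambda>b. h (solutions M n \<phi> b)) ` nlists m (carrier M)"
    then show "{b \<in> nlists m (carrier M). h (solutions M n \<phi> b) = f} \<in> definable0 L M m"
      by (rule m3[THEN conjunct2, rule_format])
  next
    fix n j X Y p f
    assume "X \<in> definable L M n" "Y \<in> definable L M j" "p \<in> X \<rightarrow> Y" "f \<in> carrier T"
      "(\<lambda>x. x @ p x) ` X \<in> definable L M (n + j) \<and> (\<forall>a\<in>Y. h {x \<in> X. p x = a} = f)"
    then show "h X = f \<otimes>\<^bsub>T\<^esub> h Y" using m4[of X n Y j p f] by blast
  qed
qed

primrec denote ::
    "('a, 'b) ord_ring_scheme \<Rightarrow> ('a \<Rightarrow> 'a) \<Rightarrow> ('x \<Rightarrow> 'a) \<Rightarrow> 'x ring_expr \<Rightarrow> 'a" where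
  "denote S neg h Zero = \<zero>\<^bsub>S\<^esub>"
| "denote S neg h One = \<one>\<^bsub>S\<^esub>"
| "denote S neg h (Gen X) = h X"
| "denote S neg h (Plus s t) = denote S neg h s \<oplus>\<^bsub>S\<^esub> denote S neg h t"
| "denote S neg h (Times s t) = denote S neg h s \<otimes>\<^bsub>S\<^esub> denote S neg h t"
| "denote S neg h (Minus t) = neg (denote S neg h t)"

definition normal_form ::
    "('a, 'b) ord_ring_scheme \<Rightarrow> ('a \<Rightarrow> 'a) \<Rightarrow> ('x \<Rightarrow> 'a) \<Rightarrow> 'x ring_expr \<Rightarrow> 'x ring_expr" where
  "normal_form S neg h t = (SOME t'. denote S neg h t' = denote S neg h t)"

definition generated ::
    "('a, 'b) ord_ring_scheme \<Rightarrow> ('a \<Rightarrow> 'a) \<Rightarrow> ('x \<Rightarrow> 'a) \<Rightarrow> 'x ring_expr ord_ring" where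
  "generated S neg h =
     \<lparr>carrier = range (normal_form S neg h),
      mult = \<lambda>s t. normal_form S neg h (Times s t), one = normal_form S neg h One,
      zero = normal_form S neg h Zero, add = \<lambda>s t. normal_form S neg h (Plus s t),
      lt = \<lambda>s t. denote S neg h s \<prec>\<^bsub>S\<^esub> denote S neg h t\<rparr>"

lemma denote_normal_form [simp]: "denote S neg h (normal_form S neg h t) = denote S neg h t"
  unfolding normal_form_def by (rule someI) simp

lemma normal_form_eq_iff:
  "normal_form S neg h s = normal_form S neg h t \<longleftrightarrow> denote S neg h s = denote S neg h t"
proof
  assume "normal_form S neg h s = normal_form S neg h t"
  then show "denote S neg h s = denote S neg h t" by (metis denote_normal_form)
next
  assume "denote S neg h s = denote S neg h t"
  then show "normal_form S neg h s = normal_form S neg h t" by (simp add: normal_form_def)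
qed

lemma denote_closed:
  assumes "semiring S" "\<And>X. h X \<in> carrier S" "\<And>x. x \<in> carrier S \<Longrightarrow> neg x \<in> carrier S"
  shows "denote S neg h t \<in> carrier S"
proof -
  interpret semiring S by fact
  show ?thesis by (induction t) (simp_all add: assms)
qed

lemma ord_embedding_generated:
  assumes "semiring S" "\<And>X. h X \<in> carrier S" "\<And>x. x \<in> carrier S \<Longrightarrow> neg x \<in> carrier S"
  shows "ord_embedding (generated S neg h) S (denote S neg h)"
  by unfold_locales (auto simp: generated_def denote_closed[OF assms] normal_form_eq_iff)

theorem generalised_measurableI:
  fixes S :: "('a, 'b) ord_ring_scheme" and M :: "('f, 'r, 'm) fo_structure"
  assumes "measurable_in L S M"
  shows "generalised_measurable L M"
proof -
  interpret S: measuring_semiring S using assms by (simp add: measurable_in_def)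
  obtain h0 where h0: "is_measure L S M h0" using assms by (auto simp: measurable_in_def)
  define h where "h = (\<lambda>X. if h0 X \<in> carrier S then h0 X else \<zero>\<^bsub>S\<^esub>)"
  define T where "T = generated S (\<lambda>x. x) h"
  interpret E: ord_embedding T S "denote S (\<lambda>x. x) h"
    unfolding T_def by (rule ord_embedding_generated) (auto simp: h_def S.semiring_axioms)
  have "measuring_semiring T"
    by (rule E.measuring_semiring) (rule S.measuring_semiring_axioms)
  moreover have "is_measure L T M (\<lambda>X. normal_form S (\<lambda>x. x) h (Gen X))"
    by (rule E.is_measure[OF S.semiring_axioms h0]) (auto simp: T_def generated_def h_def)
  ultimately show ?thesis
    unfolding generalised_measurable_def measurable_in_def by blast
qed

theorem ring_measurableI:
  fixes S :: "('a, 'b) ord_ring_scheme" and M :: "('f, 'r, 'm) fo_structure"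
  assumes S: "ordered_cring S" and m: "measurable_in L (nonneg S) M"
  shows "ring_measurable L M"
proof -
  interpret S: ordered_cring S by fact
  interpret N: measuring_semiring "nonneg S" using m by (simp add: measurable_in_def)
  obtain h0 where h0: "is_measure L (nonneg S) M h0" using m by (auto simp: measurable_in_def)
  define h where "h = (\<lambda>X. if h0 X \<in> carrier (nonneg S) then h0 X else \<zero>\<^bsub>S\<^esub>)"
  have hS: "h X \<in> carrier S" and h_nonneg: "h X \<in> carrier (nonneg S)" for X
    by (auto simp: h_def nonneg_def le_def)
  define k where "k = denote S (a_inv S) h"
  define T where "T = generated S (a_inv S) h"
  interpret E: ord_embedding T S k
    unfolding T_def k_def by (rule ord_embedding_generated) (auto simp: hS S.semiring_axioms)
  interpret T: semiring T by (rule E.semiring) unfold_locales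
  interpret T: strictly_ordered T by (rule E.strictly_ordered) unfold_locales
  have "cring T"
  proof (rule cringI)
    show "abelian_group T"
    proof (rule abelian_groupI)
      fix x assume x: "x \<in> carrier T"
      let ?y = "normal_form S (a_inv S) h (Minus x)"
      have y: "?y \<in> carrier T" by (simp add: T_def generated_def)
      moreover have "k ?y = \<ominus>\<^bsub>S\<^esub> k x" by (simp add: k_def)
      ultimately have "?y \<oplus>\<^bsub>T\<^esub> x = \<zero>\<^bsub>T\<^esub>"
        using x by (simp add: E.inj E.closed E.hom E.into S.l_neg)
      then show "\<exists>y\<in>carrier T. y \<oplus>\<^bsub>T\<^esub> x = \<zero>\<^bsub>T\<^esub>" using y by blast
    qed (simp_all add: T.add.m_ac)
    show "comm_monoid T"
      by unfold_locales (simp add: E.inj E.closed E.hom E.into S.m_comm)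
  qed (rule T.l_distr)
  then interpret T: cring T .
  have "ordered_cring T"
  proof unfold_locales
    fix x y z assume "x \<in> carrier T" "y \<in> carrier T" "z \<in> carrier T" "x \<preceq>\<^bsub>T\<^esub> y"
    then show "x \<oplus>\<^bsub>T\<^esub> z \<preceq>\<^bsub>T\<^esub> y \<oplus>\<^bsub>T\<^esub> z"
      by (simp add: E.le_iff E.closed E.hom E.into S.add_mono)
  next
    fix x y assume "x \<in> carrier T" "y \<in> carrier T" "\<zero>\<^bsub>T\<^esub> \<preceq>\<^bsub>T\<^esub> x" "\<zero>\<^bsub>T\<^esub> \<preceq>\<^bsub>T\<^esub> y"
    then show "\<zero>\<^bsub>T\<^esub> \<preceq>\<^bsub>T\<^esub> x \<otimes>\<^bsub>T\<^esub> y"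
      by (simp add: E.le_iff E.closed E.hom E.into S.mult_nonneg)
  qed
  moreover
  have ops: "\<zero>\<^bsub>nonneg R\<^esub> = \<zero>\<^bsub>R\<^esub>" "\<one>\<^bsub>nonneg R\<^esub> = \<one>\<^bsub>R\<^esub>" "x \<oplus>\<^bsub>nonneg R\<^esub> y = x \<oplus>\<^bsub>R\<^esub> y"
    "x \<otimes>\<^bsub>nonneg R\<^esub> y = x \<otimes>\<^bsub>R\<^esub> y" "x \<prec>\<^bsub>nonneg R\<^esub> y \<longleftrightarrow> x \<prec>\<^bsub>R\<^esub> y"
    for R :: "('t, 'u) ord_ring_scheme" and x y
    by (simp_all add: nonneg_def)
  have nonneg_iff: "x \<in> carrier (nonneg T) \<longleftrightarrow> x \<in> carrier T \<and> k x \<in> carrier (nonneg S)" for x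
    using E.le_iff[of "\<zero>\<^bsub>T\<^esub>" x] by (auto simp: nonneg_def E.hom E.into)
  interpret EN: ord_embedding "nonneg T" "nonneg S" k
  proof (unfold_locales, unfold ops nonneg_iff)
  qed (use E.closed E.hom E.inj E.lt_iff N.zero_closed N.one_closed N.a_closed N.m_closed in
      \<open>auto simp: ops\<close>)
  have "measuring_semiring (nonneg T)"
    by (rule EN.measuring_semiring) (rule N.measuring_semiring_axioms)
  moreover have "is_measure L (nonneg T) M (\<lambda>X. normal_form S (a_inv S) h (Gen X))"
  proof (rule EN.is_measure[OF N.semiring_axioms h0])
    show "normal_form S (a_inv S) h (Gen X) \<in> carrier (nonneg T)" for X
      by (simp add: nonneg_iff h_nonneg k_def) (simp add: T_def generated_def)
  qed (simp add: k_def h_def)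
  ultimately show ?thesis
    unfolding ring_measurable_def measurable_in_def by blast
qed

end

theory Submission
  imports Defs "HOL-Library.Function_Algebras"
begin

text \<open>
  Both parts come from one construction. Let \<open>M\<close> be the ultraproduct of finite structures \<open>M i\<close>. By
  the theorem of Los (\<open>sat_ultraproduct\<close>) a definable set \<open>X\<close> of \<open>M\<close> is internal: it is given, along
  the ultrafilter, by finite sets \<open>A i\<close> of tuples of \<open>M i\<close>. Its measure is the class of the sequence of
  sizes \<open>card (A i)\<close>. Two sequences of nonnegative reals are identified when their ratio tends to 1
  along the ultrafilter (asymptotic classes), or when they agree along it (exact classes). Both cases
  are covered by a preorder with a set \<open>E\<close> of relative errors: \<open>s \<lesssim> t\<close> if for each \<open>\<epsilon> \<in> E\<close> the
  inequality \<open>s i \<le> (1 + \<epsilon>) * t i\<close> holds along the ultrafilter. Taking \<open>E\<close> to be the positive reals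
  gives the first identification and \<open>E = {0}\<close> the second; the quotient is a measuring semiring
  (\<open>measuring_semiring_along\<close>). The delicate axiom is strict monotonicity. There \<open>x < y\<close> means that
  \<open>(1 + \<epsilon>) * x i < y i\<close> along the ultrafilter for some \<open>\<epsilon> \<in> E\<close>; after adding to both sides a quantity that
  is at most a fixed multiple of \<open>y\<close> this persists with a suitable, possibly smaller,
  element of \<open>E\<close>.

  Normalisation on finite sets, additivity and the fibre condition hold for all internal sets of any
  ultraproduct of finite structures. For the fibre condition (\<open>counting_measure_fibres\<close>), if all fibres
  over an internal set have the same measure \<open>f\<close>, then the fibres in \<open>M i\<close> have size within the factor
  \<open>1 + \<epsilon>\<close> of \<open>f i\<close> uniformly, because a choice of bad points in the \<open>M i\<close> would define a point of the
  ultraproduct over which the fibre has another measure; now sum over the base.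

  Only the definability of level sets uses the hypothesis on the class. Given a formula, each parameter
  of the ultraproduct lies, along the ultrafilter, in exactly one of the finitely many cells of the
  definable partition, and on that cell the measure is the class of the sequence \<open>h \<pi> (M i)\<close>. So every
  level set is a union of definable cells. The estimate of an asymptotic class speaks only about large
  members; they are all that matters if the ultraproduct is infinite. If it is finite, the
  measure is the cardinality, and the level sets are defined by counting quantifiers
  (\<open>definable_level_sets_finite\<close>).

  For \<open>E = {0}\<close> the semiring is the nonnegative part of the ultrapower of the ordered ring of reals, and
  an ordered ring whose nonnegative part is a measuring semiring has no zero divisors.
\<close>

section \<open>Quotients of preordered semirings\<close>

text \<open>A quotient is represented by chosen members of its classes, so that operations and order
  on classes are those on members, up to \<open>nf\<close>. The choice depends on the preorder alone and not on the set of
  members: this makes the nonnegative part of a quotient a quotient itself (\<open>nonneg_ultrapower\<close>).\<close>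

definition nf :: "('v \<Rightarrow> 'v \<Rightarrow> bool) \<Rightarrow> 'v \<Rightarrow> 'v" where
  "nf leq s = (SOME t. leq s t \<and> leq t s)"

definition order_quotient :: "'v::comm_semiring_1 set \<Rightarrow> ('v \<Rightarrow> 'v \<Rightarrow> bool) \<Rightarrow> 'v ord_ring" where
  "order_quotient A leq =
     \<lparr>carrier = nf leq ` A, mult = \<lambda>s t. nf leq (s * t), one = nf leq 1,
      zero = nf leq 0, add = \<lambda>s t. nf leq (s + t), lt = \<lambda>s t. \<not> leq t s\<rparr>"

text \<open>Multiplication is required to respect the equivalence rather than the preorder, so that the
  locale covers rings with their negative elements as well as semirings of nonnegative elements.\<close>

locale preordered_semiring =
  fixes A :: "'v::comm_semiring_1 set" and leq :: "'v \<Rightarrow> 'v \<Rightarrow> bool" (infix \<open>\<lesssim>\<close> 50)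
  assumes zero_in [simp]: "0 \<in> A" and one_in [simp]: "1 \<in> A"
    and add_in [simp]: "\<lbrakk>s \<in> A; t \<in> A\<rbrakk> \<Longrightarrow> s + t \<in> A"
    and mult_in [simp]: "\<lbrakk>s \<in> A; t \<in> A\<rbrakk> \<Longrightarrow> s * t \<in> A"
    and saturated: "\<lbrakk>s \<in> A; s \<lesssim> t; t \<lesssim> s\<rbrakk> \<Longrightarrow> t \<in> A"
    and leq_total: "\<lbrakk>s \<in> A; t \<in> A\<rbrakk> \<Longrightarrow> s \<lesssim> t \<or> t \<lesssim> s"
    and leq_trans: "\<lbrakk>s \<in> A; t \<in> A; u \<in> A; s \<lesssim> t; t \<lesssim> u\<rbrakk> \<Longrightarrow> s \<lesssim> u"
    and add_leq: "\<lbrakk>s \<in> A; t \<in> A; u \<in> A; s \<lesssim> t\<rbrakk> \<Longrightarrow> s + u \<lesssim> t + u"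
    and mult_cong: "\<lbrakk>s \<in> A; t \<in> A; u \<in> A; s \<lesssim> t; t \<lesssim> s\<rbrakk> \<Longrightarrow> s * u \<lesssim> t * u"
begin

definition equivalent :: "'v \<Rightarrow> 'v \<Rightarrow> bool" (infix \<open>\<approx>\<close> 50) where
  "s \<approx> t \<longleftrightarrow> s \<lesssim> t \<and> t \<lesssim> s"

abbreviation "Q \<equiv> order_quotient A leq"

lemma leq_refl: "s \<in> A \<Longrightarrow> s \<lesssim> s"
  using leq_total by blast

lemma nf_equivalent:
  assumes "s \<in> A" shows "s \<approx> nf leq s"
  unfolding nf_def equivalent_def by (rule someI[of _ s]) (simp add: leq_refl[OF assms])

lemma nf_in [simp]: "s \<in> A \<Longrightarrow> nf leq s \<in> A"
  using nf_equivalent saturated unfolding equivalent_def by blast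

lemma nf_leq_iff [simp]:
  assumes "s \<in> A" "t \<in> A"
  shows "nf leq s \<lesssim> t \<longleftrightarrow> s \<lesssim> t" "s \<lesssim> nf leq t \<longleftrightarrow> s \<lesssim> t"
  using nf_equivalent[of s] nf_equivalent[of t] leq_trans assms nf_in
  unfolding equivalent_def by metis+

lemma nf_eqI:
  assumes "s \<in> A" "t \<in> A" "s \<approx> t" shows "nf leq s = nf leq t"
proof -
  have "s \<lesssim> u \<and> u \<lesssim> s \<longleftrightarrow> t \<lesssim> u \<and> u \<lesssim> t" for u
    using assms saturated leq_trans unfolding equivalent_def by metis
  then show ?thesis unfolding nf_def by simp
qed

lemma nf_eq_iff:
  assumes "s \<in> A" "t \<in> A" shows "nf leq s = nf leq t \<longleftrightarrow> s \<approx> t"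
proof
  assume "nf leq s = nf leq t"
  then have "nf leq s \<lesssim> t" "t \<lesssim> nf leq s"
    using nf_equivalent[OF assms(2)] unfolding equivalent_def by auto
  then show "s \<approx> t" using assms unfolding equivalent_def by simp
qed (use assms in \<open>auto intro: nf_eqI\<close>)

lemma nf_nf [simp]: "s \<in> A \<Longrightarrow> nf leq (nf leq s) = nf leq s"
  by (rule nf_eqI) (auto simp: equivalent_def leq_refl)

lemma nf_add [simp]:
  assumes "s \<in> A" "t \<in> A"
  shows "nf leq (nf leq s + t) = nf leq (s + t)" "nf leq (t + nf leq s) = nf leq (t + s)"
proof -
  show "nf leq (nf leq s + t) = nf leq (s + t)"
    by (rule nf_eqI) (auto simp: equivalent_def assms leq_refl intro!: add_leq)
  then show "nf leq (t + nf leq s) = nf leq (t + s)" by (simp add: add.commute)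
qed

lemma nf_mult [simp]:
  assumes "s \<in> A" "t \<in> A"
  shows "nf leq (nf leq s * t) = nf leq (s * t)" "nf leq (t * nf leq s) = nf leq (t * s)"
proof -
  show "nf leq (nf leq s * t) = nf leq (s * t)"
    by (rule nf_eqI) (auto simp: equivalent_def assms leq_refl intro!: mult_cong)
  then show "nf leq (t * nf leq s) = nf leq (t * s)" by (simp add: mult.commute)
qed

lemma order_quotient_simps [simp]:
  "\<zero>\<^bsub>Q\<^esub> = nf leq 0" "\<one>\<^bsub>Q\<^esub> = nf leq 1" "s \<oplus>\<^bsub>Q\<^esub> t = nf leq (s + t)" "s \<otimes>\<^bsub>Q\<^esub> t = nf leq (s * t)"
  "s \<prec>\<^bsub>Q\<^esub> t \<longleftrightarrow> \<not> t \<lesssim> s"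
  by (simp_all add: order_quotient_def)

lemma carrier_order_quotient: "x \<in> carrier Q \<longleftrightarrow> x \<in> A \<and> nf leq x = x"
  by (force simp: order_quotient_def)

lemma le_order_quotient:
  assumes "x \<in> carrier Q" "y \<in> carrier Q" shows "x \<preceq>\<^bsub>Q\<^esub> y \<longleftrightarrow> x \<lesssim> y"
  using assms leq_total[of x y] nf_eq_iff[of x y]
  by (auto simp: le_def carrier_order_quotient equivalent_def)

lemma zero_le_order_quotient:
  assumes "x \<in> carrier Q" shows "\<zero>\<^bsub>Q\<^esub> \<preceq>\<^bsub>Q\<^esub> x \<longleftrightarrow> 0 \<lesssim> x"
  using assms by (subst le_order_quotient) (auto simp: carrier_order_quotient)

lemma semiring_order_quotient: "semiring Q"
  by unfold_locales (auto simp: carrier_order_quotient algebra_simps)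

lemma comm_monoid_order_quotient: "comm_monoid Q"
  by unfold_locales (auto simp: carrier_order_quotient algebra_simps)

lemma strictly_ordered_order_quotient: "strictly_ordered Q"
proof
  fix x assume "x \<in> carrier Q"
  then show "\<not> x \<prec>\<^bsub>Q\<^esub> x" by (simp add: carrier_order_quotient leq_refl)
next
  fix x y z assume "x \<in> carrier Q" "y \<in> carrier Q" "z \<in> carrier Q" "x \<prec>\<^bsub>Q\<^esub> y" "y \<prec>\<^bsub>Q\<^esub> z"
  then show "x \<prec>\<^bsub>Q\<^esub> z"
    using leq_trans[of z x y] leq_total[of x y] by (auto simp: carrier_order_quotient)
next
  fix x y assume xy: "x \<in> carrier Q" "y \<in> carrier Q"
  then show "x \<prec>\<^bsub>Q\<^esub> y \<or> x = y \<or> y \<prec>\<^bsub>Q\<^esub> x"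
    using nf_eq_iff[of x y] by (auto simp: carrier_order_quotient equivalent_def)
qed

lemma add_mono_order_quotient:
  assumes "x \<in> carrier Q" "y \<in> carrier Q" "z \<in> carrier Q" "x \<preceq>\<^bsub>Q\<^esub> y"
  shows "x \<oplus>\<^bsub>Q\<^esub> z \<preceq>\<^bsub>Q\<^esub> y \<oplus>\<^bsub>Q\<^esub> z"
proof -
  interpret semiring Q by (rule semiring_order_quotient)
  have "x \<lesssim> y" using assms by (simp add: le_order_quotient)
  then have "x + z \<lesssim> y + z" using assms by (simp add: carrier_order_quotient add_leq)
  then show ?thesis
    using assms by (subst le_order_quotient) (auto simp: carrier_order_quotient)
qed

lemma add_pow_order_quotient:
  assumes "s \<in> A" shows "[(n::nat)] \<cdot>\<^bsub>Q\<^esub> nf leq s = nf leq (of_nat n * s)"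
proof (induction n)
  case (Suc n)
  have "of_nat n * s \<in> A" 
  proof (induction n)
    case (Suc n)
    then show ?case using assms by (simp add: algebra_simps)
  qed simp
  moreover have "[Suc n] \<cdot>\<^bsub>Q\<^esub> nf leq s = [n] \<cdot>\<^bsub>Q\<^esub> nf leq s \<oplus>\<^bsub>Q\<^esub> nf leq s"
    by (simp add: add_pow_def nat_pow_def)
  ultimately show ?case using Suc assms by (simp add: algebra_simps)
qed (simp add: add_pow_def nat_pow_def)

end

section \<open>Sequences compared along an ultrafilter\<close>

text \<open>The elements of \<open>E\<close> are the relative errors that are tolerated.\<close>

definition leq_along :: "'i filter \<Rightarrow> real set \<Rightarrow> ('i \<Rightarrow> real) \<Rightarrow> ('i \<Rightarrow> real) \<Rightarrow> bool" where
  "leq_along U E s t \<longleftrightarrow> (\<forall>\<epsilon>\<in>E. \<forall>\<^sub>F i in U. s i \<le> (1 + \<epsilon>) * t i)"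

definition nonneg_along :: "'i filter \<Rightarrow> ('i \<Rightarrow> real) set" where
  "nonneg_along U = {s. \<forall>\<^sub>F i in U. 0 \<le> s i}"

lemma ultrafilter_eventually_not_iff:
  assumes "ultrafilter U" shows "(\<forall>\<^sub>F i in U. \<not> P i) \<longleftrightarrow> \<not> (\<forall>\<^sub>F i in U. P i)"
  using assms eventually_conj[of P U "\<lambda>i. \<not> P i"] unfolding ultrafilter_def by auto

text \<open>The last condition makes \<open>E\<close> contain, below each of its elements, errors that are smaller by any
  given factor. Then errors may be composed (transitivity) and absorbed after enlarging by a fixed
  multiple (\<open>add_not_leq_along\<close>).\<close>

locale tolerance =
  fixes U :: "'i filter" and E :: "real set"
  assumes U: "ultrafilter U"
    and tol_nonempty: "E \<noteq> {}"
    and tol_nonneg: "\<epsilon> \<in> E \<Longrightarrow> 0 \<le> \<epsilon>"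
    and tol_small: "\<epsilon> \<in> E \<Longrightarrow> \<exists>\<delta>\<in>E. \<delta> \<le> 1 \<and> K * \<delta> \<le> \<epsilon>"
begin

abbreviation leqs (infix \<open>\<lesssim>\<close> 50) where "s \<lesssim> t \<equiv> leq_along U E s t"

lemma leq_alongD: "\<lbrakk>s \<lesssim> t; \<epsilon> \<in> E\<rbrakk> \<Longrightarrow> \<forall>\<^sub>F i in U. s i \<le> (1 + \<epsilon>) * t i"
  by (simp add: leq_along_def)

lemma not_leq_alongD: "\<not> s \<lesssim> t \<Longrightarrow> \<exists>\<epsilon>\<in>E. \<forall>\<^sub>F i in U. (1 + \<epsilon>) * t i < s i"
  by (auto simp: leq_along_def not_le[symmetric] ultrafilter_eventually_not_iff[OF U])

lemma not_leq_alongI: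
  assumes "\<epsilon> \<in> E" "\<forall>\<^sub>F i in U. (1 + \<epsilon>) * t i < s i" shows "\<not> s \<lesssim> t"
  using assms by (auto simp: leq_along_def not_le[symmetric] ultrafilter_eventually_not_iff[OF U])

lemma leq_along_pointwise:
  assumes "\<forall>\<^sub>F i in U. s i \<le> t i" "t \<in> nonneg_along U" shows "s \<lesssim> t"
  unfolding leq_along_def
proof
  fix \<epsilon> assume "\<epsilon> \<in> E"
  then have "0 \<le> \<epsilon>" by (rule tol_nonneg)
  then have *: "t i \<le> (1 + \<epsilon>) * t i" if "0 \<le> t i" for i
    using that mult_right_mono[of 1 "1 + \<epsilon>" "t i"] by simp
  show "\<forall>\<^sub>F i in U. s i \<le> (1 + \<epsilon>) * t i"
    using assms(1) assms(2)[unfolded nonneg_along_def mem_Collect_eq]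
    by eventually_elim (use * order_trans in blast)
qed

lemma mult_leq_along:
  assumes "s \<lesssim> t" "u \<in> nonneg_along U" shows "s * u \<lesssim> t * u"
  unfolding leq_along_def
proof
  fix \<epsilon> assume "\<epsilon> \<in> E"
  from leq_alongD[OF assms(1) this] assms(2) show "\<forall>\<^sub>F i in U. (s * u) i \<le> (1 + \<epsilon>) * (t * u) i"
    unfolding nonneg_along_def mem_Collect_eq
    by eventually_elim (simp add: mult.assoc[symmetric] mult_right_mono)
qed

sublocale preordered_semiring "nonneg_along U" "leq_along U E"
proof
  show "0 \<in> nonneg_along U" "1 \<in> nonneg_along U" by (simp_all add: nonneg_along_def)
  fix s t assume st: "s \<in> nonneg_along U" "t \<in> nonneg_along U"
  show "s + t \<in> nonneg_along U" "s * t \<in> nonneg_along U"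
    using st unfolding nonneg_along_def mem_Collect_eq by (eventually_elim, simp)+
  show "s \<lesssim> t \<or> t \<lesssim> s"
  proof (cases "\<forall>\<^sub>F i in U. s i \<le> t i")
    case False
    then have "\<forall>\<^sub>F i in U. t i \<le> s i"
      by (subst (asm) ultrafilter_eventually_not_iff[OF U, symmetric]) (auto elim: eventually_mono)
    then show ?thesis using leq_along_pointwise st by blast
  qed (use leq_along_pointwise st in blast)
next
  fix s t assume s: "s \<in> nonneg_along U" and st: "s \<lesssim> t" "t \<lesssim> s"
  obtain \<epsilon> where \<epsilon>: "\<epsilon> \<in> E" using tol_nonempty by blast
  from s leq_alongD[OF st(1) \<epsilon>] show "t \<in> nonneg_along U"
    unfolding nonneg_along_def mem_Collect_eq
  proof eventually_elim
    case (elim i)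
    then have "0 \<le> (1 + \<epsilon>) * t i" by linarith
    then show ?case using tol_nonneg[OF \<epsilon>] by (simp add: zero_le_mult_iff)
  qed
next
  fix s t u assume A: "s \<in> nonneg_along U" "t \<in> nonneg_along U" "u \<in> nonneg_along U"
  assume st: "s \<lesssim> t" and tu: "t \<lesssim> u"
  show "s \<lesssim> u" unfolding leq_along_def
  proof
    fix \<epsilon> assume "\<epsilon> \<in> E"
    \<comment> \<open>for \<open>\<delta> \<le> 1\<close> the composed error \<open>(1 + \<delta>)\<^sup>2 - 1\<close> is at most \<open>3 * \<delta>\<close>\<close>
    then obtain \<delta> where \<delta>: "\<delta> \<in> E" "\<delta> \<le> 1" "3 * \<delta> \<le> \<epsilon>" using tol_small by blast
    have d: "0 \<le> \<delta>" using \<delta>(1) by (rule tol_nonneg)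
    from leq_alongD[OF st \<delta>(1)] leq_alongD[OF tu \<delta>(1)] A(3)[unfolded nonneg_along_def mem_Collect_eq]
    show "\<forall>\<^sub>F i in U. s i \<le> (1 + \<epsilon>) * u i"
    proof eventually_elim
      case (elim i)
      have "s i \<le> (1 + \<delta>) * ((1 + \<delta>) * u i)"
        using elim(1) mult_left_mono[OF elim(2), of "1 + \<delta>"] d by linarith
      also have "\<dots> = (1 + 2 * \<delta> + \<delta> * \<delta>) * u i" by (simp add: algebra_simps)
      also have "\<dots> \<le> (1 + \<epsilon>) * u i"
        using elim(3) \<delta> mult_left_mono[OF \<delta>(2) d] by (intro mult_right_mono) auto
      finally show ?case .
    qed
  qed
next
  fix s t u assume A: "s \<in> nonneg_along U" "t \<in> nonneg_along U" "u \<in> nonneg_along U" and st: "s \<lesssim> t"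
  show "s + u \<lesssim> t + u" unfolding leq_along_def
  proof
    fix \<epsilon> assume \<epsilon>: "\<epsilon> \<in> E"
    from leq_alongD[OF st \<epsilon>] A(3)[unfolded nonneg_along_def mem_Collect_eq]
    show "\<forall>\<^sub>F i in U. (s + u) i \<le> (1 + \<epsilon>) * (t + u) i"
    proof eventually_elim
      case (elim i)
      have "0 \<le> \<epsilon> * u i" using elim(2) tol_nonneg[OF \<epsilon>] by simp
      then show ?case using elim(1) by (simp add: algebra_simps)
    qed
  qed
next
  fix s t u assume "u \<in> nonneg_along U" "s \<lesssim> t"
  then show "s * u \<lesssim> t * u" by (rule mult_leq_along[rotated])
qed

lemma zero_leq_along: "s \<in> nonneg_along U \<Longrightarrow> 0 \<lesssim> s"
  by (rule leq_along_pointwise) (auto simp: nonneg_along_def)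

lemma not_leq_zero_iff: "\<not> s \<lesssim> 0 \<longleftrightarrow> (\<forall>\<^sub>F i in U. 0 < s i)"
  using tol_nonempty by (auto simp: leq_along_def not_le[symmetric] ultrafilter_eventually_not_iff[OF U])

lemma ordered_semiring_along: "ordered_semiring Q"
proof -
  interpret Q: semiring Q by (rule semiring_order_quotient)
  interpret Q: comm_monoid Q by (rule comm_monoid_order_quotient)
  interpret Q: strictly_ordered Q by (rule strictly_ordered_order_quotient)
  show ?thesis
  proof unfold_locales
    fix x assume "x \<in> carrier Q"
    then show "\<zero>\<^bsub>Q\<^esub> \<preceq>\<^bsub>Q\<^esub> x"
      by (subst zero_le_order_quotient) (auto simp: carrier_order_quotient zero_leq_along)
  next
    fix x y z assume *: "x \<in> carrier Q" "y \<in> carrier Q" "z \<in> carrier Q" "x \<preceq>\<^bsub>Q\<^esub> y"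
    then show "x \<oplus>\<^bsub>Q\<^esub> z \<preceq>\<^bsub>Q\<^esub> y \<oplus>\<^bsub>Q\<^esub> z" by (rule add_mono_order_quotient)
    have "x * z \<lesssim> y * z"
      using * by (intro mult_leq_along) (auto simp: le_order_quotient carrier_order_quotient)
    then show "x \<otimes>\<^bsub>Q\<^esub> z \<preceq>\<^bsub>Q\<^esub> y \<otimes>\<^bsub>Q\<^esub> z"
      using * by (subst le_order_quotient) (auto simp: carrier_order_quotient)
  next
    fix x y assume *: "x \<in> carrier Q" "y \<in> carrier Q" "\<zero>\<^bsub>Q\<^esub> \<prec>\<^bsub>Q\<^esub> x" "\<zero>\<^bsub>Q\<^esub> \<prec>\<^bsub>Q\<^esub> y"
    then have "\<forall>\<^sub>F i in U. 0 < x i" "\<forall>\<^sub>F i in U. 0 < y i"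
      by (auto simp: carrier_order_quotient not_leq_zero_iff)
    then have "\<forall>\<^sub>F i in U. 0 < (x * y) i" by eventually_elim simp
    then show "\<zero>\<^bsub>Q\<^esub> \<prec>\<^bsub>Q\<^esub> x \<otimes>\<^bsub>Q\<^esub> y"
      using * by (auto simp: carrier_order_quotient not_leq_zero_iff)
  next
    have "\<not> 1 \<lesssim> 0" unfolding not_leq_zero_iff by simp
    then show "\<zero>\<^bsub>Q\<^esub> \<noteq> \<one>\<^bsub>Q\<^esub>" by (simp add: nf_eq_iff equivalent_def)
  qed
qed

text \<open>If \<open>x\<close> is below \<open>y\<close> by the factor \<open>1 + \<epsilon>\<close> and \<open>z\<close> is at most \<open>N * y\<close>, then \<open>x + z\<close> is below \<open>y + z\<close>
  by the factor \<open>1 + \<delta>\<close>, provided \<open>\<delta>\<close> is small relative to \<open>\<epsilon>\<close> and \<open>N\<close>. The bound on \<open>z\<close> expresses that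
  \<open>z\<close> has at most the dimension of \<open>y\<close>.\<close>

lemma add_not_leq_along:
  assumes A: "x \<in> nonneg_along U" "y \<in> nonneg_along U" "z \<in> nonneg_along U"
    and xy: "\<not> y \<lesssim> x" and zy: "z \<lesssim> of_nat n * y"
  shows "\<not> y + z \<lesssim> x + z"
proof -
  obtain \<epsilon> where \<epsilon>: "\<epsilon> \<in> E" and xy': "\<forall>\<^sub>F i in U. (1 + \<epsilon>) * x i < y i"
    using not_leq_alongD[OF xy] by blast
  define N where "N = (1 + \<epsilon>) * real n"
  \<comment> \<open>\<open>(1 + \<delta>) * x + \<delta> * z < ((1 + \<delta>) / (1 + \<epsilon>) + \<delta> * N) * y\<close>, and this \<open>\<delta>\<close> makes the factor of \<open>y\<close> at most 1.\<close>
  obtain \<delta> where \<delta>: "\<delta> \<in> E" "(1 + N * (1 + \<epsilon>)) * \<delta> \<le> \<epsilon>" using tol_small[OF \<epsilon>] by blast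
  have \<epsilon>0: "0 \<le> \<epsilon>" and \<delta>0: "0 \<le> \<delta>" using \<epsilon> \<delta> tol_nonneg by auto
  have "\<forall>\<^sub>F i in U. (1 + \<delta>) * (x + z) i < (y + z) i"
    using xy' leq_alongD[OF zy \<epsilon>] A(2)[unfolded nonneg_along_def mem_Collect_eq]
  proof eventually_elim
    case (elim i)
    have "(of_nat n * y) i = real n * y i" by (simp add: of_nat_fun)
    then have z: "z i \<le> N * y i" using elim(2) by (simp add: N_def mult.assoc)
    have "(1 + \<delta>) * ((1 + \<epsilon>) * x i) < (1 + \<delta>) * y i"
      using elim(1) \<delta>0 by (intro mult_strict_left_mono) auto
    moreover have "(1 + \<epsilon>) * (\<delta> * z i) \<le> (1 + \<epsilon>) * (\<delta> * (N * y i))"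
      using z \<epsilon>0 \<delta>0 by (intro mult_left_mono) auto
    moreover have "(1 + N * (1 + \<epsilon>)) * \<delta> * y i \<le> \<epsilon> * y i"
      using \<delta>(2) elim(3) by (rule mult_right_mono)
    ultimately have "(1 + \<epsilon>) * ((1 + \<delta>) * x i + \<delta> * z i) < (1 + \<epsilon>) * y i"
      by (simp add: algebra_simps)
    then have "(1 + \<delta>) * x i + \<delta> * z i < y i" using \<epsilon>0 by simp
    then show ?case by (simp add: algebra_simps)
  qed
  then show ?thesis using not_leq_alongI[OF \<delta>(1)] by blast
qed

lemma measuring_semiring_along: "measuring_semiring Q"
proof -
  interpret Q: ordered_semiring Q by (rule ordered_semiring_along)
  show ?thesis
  proof
    fix x y z assume *: "x \<in> carrier Q" "y \<in> carrier Q" "z \<in> carrier Q" "x \<prec>\<^bsub>Q\<^esub> y"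
      and d: "dimension Q y = dimension Q z"
    note A = *(1-3)[unfolded carrier_order_quotient]
    obtain n :: nat where "z \<preceq>\<^bsub>Q\<^esub> [n] \<cdot>\<^bsub>Q\<^esub> y"
      using d * by (auto simp: Q.dimension_eq_iff Q.archimedean_equiv_alt)
    moreover have "[n] \<cdot>\<^bsub>Q\<^esub> y = nf (leq_along U E) (of_nat n * y)"
      using add_pow_order_quotient[of y n] A by simp
    moreover have "of_nat n * y \<in> nonneg_along U"
      using A(2) by (auto simp: nonneg_along_def of_nat_fun elim: eventually_mono)
    ultimately have "z \<lesssim> of_nat n * y"
      using * A Q.add.nat_pow_closed[of y n] by (simp add: le_order_quotient)
    then have "\<not> y + z \<lesssim> x + z"
      using A *(4) by (intro add_not_leq_along) auto
    then show "x \<oplus>\<^bsub>Q\<^esub> z \<prec>\<^bsub>Q\<^esub> y \<oplus>\<^bsub>Q\<^esub> z" using A by simp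
  qed
qed

end

lemma tolerance_positive: "ultrafilter U \<Longrightarrow> tolerance U {0<..}"
proof (unfold_locales, goal_cases)
  case (4 \<epsilon> K)
  have "\<exists>\<delta>. 0 < \<delta> \<and> \<delta> \<le> 1 \<and> K * \<delta> \<le> \<epsilon>"
  proof (intro exI conjI)
    let ?d = "min 1 (\<epsilon> / (\<bar>K\<bar> + 1))"
    show "0 < ?d" using 4 by simp
    have "K * ?d \<le> (\<bar>K\<bar> + 1) * (\<epsilon> / (\<bar>K\<bar> + 1))"
      using 4 by (intro mult_mono) auto
    then show "K * ?d \<le> \<epsilon>" by simp
  qed simp
  then show ?case by auto
qed auto

lemma tolerance_zero: "ultrafilter U \<Longrightarrow> tolerance U {0}"
  by unfold_locales auto

lemma leq_along_zero: "leq_along U {0} s t \<longleftrightarrow> (\<forall>\<^sub>F i in U. s i \<le> t i)"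
  by (simp add: leq_along_def)

lemma preordered_semiring_ultrapower:
  assumes U: "ultrafilter U" shows "preordered_semiring UNIV (leq_along U {0})"
proof (unfold_locales, goal_cases)
  case (6 s t)
  have "\<forall>\<^sub>F i in U. t i \<le> s i" if "\<not> (\<forall>\<^sub>F i in U. s i \<le> t i)"
    using that unfolding ultrafilter_eventually_not_iff[OF U, symmetric] by (rule eventually_mono) simp
  then show ?case unfolding leq_along_zero by blast
qed (auto simp: leq_along_zero elim: eventually_elim2 eventually_mono)

lemma ordered_cring_ultrapower:
  assumes U: "ultrafilter U" shows "ordered_cring (order_quotient UNIV (leq_along U {0}))"
proof -
  let ?le = "leq_along U {0}"
  interpret preordered_semiring UNIV ?le by (rule preordered_semiring_ultrapower[OF U])
  interpret Q: semiring Q by (rule semiring_order_quotient)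
  interpret Q: comm_monoid Q by (rule comm_monoid_order_quotient)
  interpret Q: strictly_ordered Q by (rule strictly_ordered_order_quotient)
  have "cring Q"
  proof (rule cringI)
    show "abelian_group Q"
    proof (rule abelian_groupI)
      fix x assume "x \<in> carrier Q"
      moreover have "nf ?le (- x) \<in> carrier Q" by (simp add: carrier_order_quotient)
      moreover have "nf ?le (- x) \<oplus>\<^bsub>Q\<^esub> x = \<zero>\<^bsub>Q\<^esub>" by simp
      ultimately show "\<exists>y\<in>carrier Q. y \<oplus>\<^bsub>Q\<^esub> x = \<zero>\<^bsub>Q\<^esub>" by blast
    qed (auto simp: carrier_order_quotient algebra_simps)
  qed (use Q.comm_monoid_axioms Q.l_distr in auto)
  then interpret Q: cring Q .
  show ?thesis
  proof unfold_locales
    fix x y assume *: "x \<in> carrier Q" "y \<in> carrier Q" "\<zero>\<^bsub>Q\<^esub> \<preceq>\<^bsub>Q\<^esub> x" "\<zero>\<^bsub>Q\<^esub> \<preceq>\<^bsub>Q\<^esub> y"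
    then have "\<forall>\<^sub>F i in U. 0 \<le> x i" "\<forall>\<^sub>F i in U. 0 \<le> y i"
      using zero_le_order_quotient leq_along_zero[of U 0] by auto
    then have "\<forall>\<^sub>F i in U. 0 \<le> (x * y) i" by eventually_elim simp
    then have "?le 0 (x * y)" by (simp add: leq_along_zero)
    then show "\<zero>\<^bsub>Q\<^esub> \<preceq>\<^bsub>Q\<^esub> x \<otimes>\<^bsub>Q\<^esub> y"
      unfolding zero_le_order_quotient[OF Q.m_closed[OF *(1,2)]] by simp
  qed (rule add_mono_order_quotient)
qed

text \<open>A sequence that is nonnegative along the ultrafilter is equivalent only to such sequences, so the
  nonnegative classes of the ultrapower are the classes of \<open>nonneg_along U\<close>.\<close>

lemma nonneg_ultrapower:
  assumes U: "ultrafilter U"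
  shows "nonneg (order_quotient UNIV (leq_along U {0})) =
    order_quotient (nonneg_along U) (leq_along U {0})"
proof -
  let ?le = "leq_along U {0}"
  interpret R: preordered_semiring UNIV ?le by (rule preordered_semiring_ultrapower[OF U])
  interpret N: tolerance U "{0}" by (rule tolerance_zero[OF U])
  have "\<zero>\<^bsub>R.Q\<^esub> \<preceq>\<^bsub>R.Q\<^esub> x \<longleftrightarrow> x \<in> nonneg_along U" if "x \<in> carrier R.Q" for x
    unfolding R.zero_le_order_quotient[OF that]
    by (simp add: leq_along_zero nonneg_along_def)
  then have "{x \<in> carrier R.Q. \<zero>\<^bsub>R.Q\<^esub> \<preceq>\<^bsub>R.Q\<^esub> x} = carrier N.Q"
    by (auto simp: R.carrier_order_quotient N.carrier_order_quotient)
  then show ?thesis by (simp add: nonneg_def order_quotient_def)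
qed

text \<open>A product of nonzero elements is, up to sign, a product of positive ones, and the nonnegative part
  is closed under products of positive elements by \<open>mult_pos\<close>.\<close>

lemma domain_ordered_cring:
  assumes "ordered_cring S" "measuring_semiring (nonneg S)" shows "domain S"
proof -
  interpret ordered_cring S by fact
  interpret N: measuring_semiring "nonneg S" by fact
  have pos: "\<zero>\<^bsub>S\<^esub> \<prec>\<^bsub>S\<^esub> x \<otimes>\<^bsub>S\<^esub> y"
    if "x \<in> carrier S" "y \<in> carrier S" "\<zero>\<^bsub>S\<^esub> \<prec>\<^bsub>S\<^esub> x" "\<zero>\<^bsub>S\<^esub> \<prec>\<^bsub>S\<^esub> y" for x y
    using N.mult_pos[of x y] that by (simp add: nonneg_def le_def)
  have neg: "\<zero>\<^bsub>S\<^esub> \<prec>\<^bsub>S\<^esub> \<ominus>\<^bsub>S\<^esub> x" if x: "x \<in> carrier S" "x \<prec>\<^bsub>S\<^esub> \<zero>\<^bsub>S\<^esub>" for x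
  proof -
    have "\<zero>\<^bsub>S\<^esub> \<preceq>\<^bsub>S\<^esub> \<ominus>\<^bsub>S\<^esub> x"
      using add_mono[of x "\<zero>\<^bsub>S\<^esub>" "\<ominus>\<^bsub>S\<^esub> x"] x by (simp add: le_def r_neg)
    moreover have "\<ominus>\<^bsub>S\<^esub> x \<noteq> \<zero>\<^bsub>S\<^esub>" using x lt_irrefl by (metis add.inv_eq_1_iff)
    ultimately show ?thesis by (auto simp: le_def)
  qed
  have ppos: "x \<otimes>\<^bsub>S\<^esub> y \<noteq> \<zero>\<^bsub>S\<^esub>"
    if "x \<in> carrier S" "y \<in> carrier S" "\<zero>\<^bsub>S\<^esub> \<prec>\<^bsub>S\<^esub> x" "\<zero>\<^bsub>S\<^esub> \<prec>\<^bsub>S\<^esub> y" for x y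
    using pos[OF that] lt_irrefl[of "\<zero>\<^bsub>S\<^esub>"] by auto
  have "x \<otimes>\<^bsub>S\<^esub> y \<noteq> \<zero>\<^bsub>S\<^esub>"
    if x: "x \<in> carrier S" "x \<noteq> \<zero>\<^bsub>S\<^esub>" and y: "y \<in> carrier S" "y \<noteq> \<zero>\<^bsub>S\<^esub>" for x y
  proof
    assume "x \<otimes>\<^bsub>S\<^esub> y = \<zero>\<^bsub>S\<^esub>"
    then have "\<ominus>\<^bsub>S\<^esub> x \<otimes>\<^bsub>S\<^esub> y = \<zero>\<^bsub>S\<^esub>" "x \<otimes>\<^bsub>S\<^esub> \<ominus>\<^bsub>S\<^esub> y = \<zero>\<^bsub>S\<^esub>" "\<ominus>\<^bsub>S\<^esub> x \<otimes>\<^bsub>S\<^esub> \<ominus>\<^bsub>S\<^esub> y = \<zero>\<^bsub>S\<^esub>"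
      using x y by (simp_all add: l_minus r_minus)
    with \<open>x \<otimes>\<^bsub>S\<^esub> y = \<zero>\<^bsub>S\<^esub>\<close> show False
      using ppos neg x y lt_total[of x "\<zero>\<^bsub>S\<^esub>"] lt_total[of y "\<zero>\<^bsub>S\<^esub>"] by (metis a_inv_closed zero_closed)
  qed
  then show ?thesis
    using N.zero_neq_one by unfold_locales (auto simp: nonneg_def)
qed

section \<open>Ultraproducts\<close>

text \<open>The representatives are those through which \<open>ultraproduct\<close> interprets the symbols, so the
  interpretation of a symbol at a tuple is literally determined by the coordinates.\<close>

definition coord :: "'i \<Rightarrow> ('i \<Rightarrow> 'a) set list \<Rightarrow> 'a list" where
  "coord i Xs = map (\<lambda>X. (SOME x. x \<in> X) i) Xs"

lemma coord_simps [simp]: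
  "coord i [] = []" "coord i (X # Xs) = (SOME x. x \<in> X) i # coord i Xs"
  "coord i (Xs @ Ys) = coord i Xs @ coord i Ys" "length (coord i Xs) = length Xs"
  by (simp_all add: coord_def)

lemma coord_nth: "j < length Xs \<Longrightarrow> coord i Xs ! j = (SOME x. x \<in> Xs ! j) i"
  by (simp add: coord_def)

locale ultraproduct_structure =
  fixes L :: "('f, 'r) language" and U :: "'i filter" and M :: "'i \<Rightarrow> ('f, 'r, 'a) fo_structure"
  assumes ultrafilter: "ultrafilter U" and structures: "is_structure L (M i)"
begin

abbreviation MU where "MU \<equiv> ultraproduct U M"

definition germ :: "('i \<Rightarrow> 'a) \<Rightarrow> ('i \<Rightarrow> 'a) set" where
  "germ x = ultra_rel U M `` {x}"

lemma eventually_not_iff: "(\<forall>\<^sub>F i in U. \<not> P i) \<longleftrightarrow> \<not> (\<forall>\<^sub>F i in U. P i)"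
  by (rule ultrafilter_eventually_not_iff[OF ultrafilter])

lemma eventually_disj_iff: "(\<forall>\<^sub>F i in U. P i \<or> Q i) \<longleftrightarrow> (\<forall>\<^sub>F i in U. P i) \<or> (\<forall>\<^sub>F i in U. Q i)"
  using eventually_not_iff[of "\<lambda>i. P i \<or> Q i"] eventually_not_iff[of P] eventually_not_iff[of Q]
  by (auto simp: eventually_conj_iff)

lemma eventually_impI:
  assumes "(\<forall>\<^sub>F i in U. P i) \<Longrightarrow> \<forall>\<^sub>F i in U. R i" shows "\<forall>\<^sub>F i in U. P i \<longrightarrow> R i"
proof (cases "\<forall>\<^sub>F i in U. P i")
  case True
  from assms[OF this] show ?thesis by (rule eventually_mono) simp
next
  case False
  then have "\<forall>\<^sub>F i in U. \<not> P i" by (simp add: eventually_not_iff)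
  then show ?thesis by (rule eventually_mono) simp
qed

lemma eventually_Bex_finite:
  assumes "finite P" "\<forall>\<^sub>F i in U. \<exists>p\<in>P. R i p" shows "\<exists>p\<in>P. \<forall>\<^sub>F i in U. R i p"
proof (rule ccontr)
  assume "\<not> ?thesis"
  then have "\<forall>p\<in>P. \<forall>\<^sub>F i in U. \<not> R i p" by (simp add: eventually_not_iff)
  then have "\<forall>\<^sub>F i in U. \<forall>p\<in>P. \<not> R i p" by (rule eventually_ball_finite[OF assms(1)])
  then show False using assms(2) eventually_not_iff[of "\<lambda>i. \<exists>p\<in>P. R i p"] by simp
qed

lemma equiv_ultra_rel: "equiv (Pi UNIV (\<lambda>i. carrier (M i))) (ultra_rel U M)"
proof (rule equivI)
  show "trans (ultra_rel U M)"
    by (rule transI) (auto simp: ultra_rel_def elim: eventually_elim2)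
  have "(\<forall>\<^sub>F i in U. y i = x i) = (\<forall>\<^sub>F i in U. x i = y i)" for x y :: "'i \<Rightarrow> 'a"
    by (simp only: eq_commute)
  then show "sym (ultra_rel U M)" by (auto simp: ultra_rel_def sym_def)
qed (auto simp: ultra_rel_def refl_on_def)

lemma carrier_MU: "carrier MU = Pi UNIV (\<lambda>i. carrier (M i)) // ultra_rel U M"
  by (simp add: ultraproduct_def)

lemma germ_in: "(\<And>i. x i \<in> carrier (M i)) \<Longrightarrow> germ x \<in> carrier MU"
  by (auto simp: carrier_MU germ_def intro: quotientI)

lemma representative_in: "X \<in> carrier MU \<Longrightarrow> (SOME x. x \<in> X) \<in> X"
  using in_quotient_imp_non_empty[OF equiv_ultra_rel] carrier_MU by (auto simp: some_in_eq)

lemma representative_carrier: "X \<in> carrier MU \<Longrightarrow> (SOME x. x \<in> X) i \<in> carrier (M i)"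
  using in_quotient_imp_subset[OF equiv_ultra_rel] representative_in carrier_MU by blast

lemma representative_germ:
  assumes "\<And>i. x i \<in> carrier (M i)" shows "\<forall>\<^sub>F i in U. (SOME y. y \<in> germ x) i = x i"
  using representative_in[OF germ_in[OF assms]]
  by (auto simp: germ_def ultra_rel_def elim: eventually_mono)

lemma carrier_MU_eqI:
  assumes "X \<in> carrier MU" "Y \<in> carrier MU"
    and "\<forall>\<^sub>F i in U. (SOME x. x \<in> X) i = (SOME y. y \<in> Y) i"
  shows "X = Y"
  by (rule quotient_eqI[OF equiv_ultra_rel assms(1,2)[unfolded carrier_MU]
        assms(1,2)[THEN representative_in]])
    (use assms representative_carrier in \<open>auto simp: ultra_rel_def\<close>)

lemma coord_in: "Xs \<in> nlists n (carrier MU) \<Longrightarrow> coord i Xs \<in> nlists n (carrier (M i))"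
  unfolding nlists_def coord_def mem_Collect_eq length_map set_map image_subset_iff
  using representative_carrier by blast

lemma tuple_with_coords:
  assumes "\<And>i. a i \<in> nlists n (carrier (M i))"
  shows "\<exists>Xs\<in>nlists n (carrier MU). \<forall>\<^sub>F i in U. coord i Xs = a i"
  using assms
proof (induction n arbitrary: a)
  case (Suc n)
  have a: "hd (a i) \<in> carrier (M i)" "tl (a i) \<in> nlists n (carrier (M i))" "a i \<noteq> []" for i
    using Suc.prems[of i] unfolding in_nlists_Suc_iff by force+
  obtain Xs where Xs: "Xs \<in> nlists n (carrier MU)" and ev: "\<forall>\<^sub>F i in U. coord i Xs = tl (a i)"
    using Suc.IH[OF a(2)] by blast
  have "\<forall>\<^sub>F i in U. coord i (germ (\<lambda>i. hd (a i)) # Xs) = a i"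
    using ev representative_germ[OF a(1)] by eventually_elim (simp add: a)
  moreover have "germ (\<lambda>i. hd (a i)) # Xs \<in> nlists (Suc n) (carrier MU)"
    using Xs germ_in[OF a(1)] by simp
  ultimately show ?case by blast
qed simp

lemma tuple_eqI:
  assumes "Xs \<in> nlists n (carrier MU)" "Ys \<in> nlists n (carrier MU)"
    and "\<forall>\<^sub>F i in U. coord i Xs = coord i Ys"
  shows "Xs = Ys"
  using assms
proof (induction n arbitrary: Xs Ys)
  case (Suc n)
  from Suc.prems(1,2) obtain X Xs' Y Ys' where *: "Xs = X # Xs'" "Ys = Y # Ys'" "X \<in> carrier MU" "Y \<in> carrier MU"
    "Xs' \<in> nlists n (carrier MU)" "Ys' \<in> nlists n (carrier MU)"
    by (auto simp: in_nlists_Suc_iff)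
  with Suc.prems(3) have "\<forall>\<^sub>F i in U. (SOME x. x \<in> X) i = (SOME y. y \<in> Y) i"
    "\<forall>\<^sub>F i in U. coord i Xs' = coord i Ys'"
    by (auto elim: eventually_mono)
  then show ?case using * Suc.IH[of Xs' Ys'] carrier_MU_eqI[of X Y] by simp
qed simp

text \<open>The transfer principle that replaces saturation: if the property failed along the ultrafilter,
  the failing tuples, chosen one in each \<open>M i\<close>, would be the coordinates of a tuple of the
  ultraproduct.\<close>

lemma eventually_all_tuples:
  assumes "\<And>Xs. Xs \<in> nlists n (carrier MU) \<Longrightarrow> \<forall>\<^sub>F i in U. P i (coord i Xs)"
  shows "\<forall>\<^sub>F i in U. \<forall>a\<in>nlists n (carrier (M i)). P i a"
proof (rule ccontr)
  assume "\<not> ?thesis"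
  then have bad: "\<forall>\<^sub>F i in U. \<exists>a\<in>nlists n (carrier (M i)). \<not> P i a"
    by (simp add: eventually_not_iff[symmetric])
  have "\<exists>a. a \<in> nlists n (carrier (M i)) \<and> ((\<exists>a\<in>nlists n (carrier (M i)). \<not> P i a) \<longrightarrow> \<not> P i a)" for i
  proof (cases "\<exists>a\<in>nlists n (carrier (M i)). \<not> P i a")
    case False
    have "carrier (M i) \<noteq> {}" using structures by (simp add: is_structure_def)
    from nlists_not_empty[OF this] False show ?thesis by simp
  qed blast
  then obtain a where a: "a i \<in> nlists n (carrier (M i))"
    and *: "(\<exists>a\<in>nlists n (carrier (M i)). \<not> P i a) \<Longrightarrow> \<not> P i (a i)" for i
    by metis
  obtain Xs where "Xs \<in> nlists n (carrier MU)" and Xs: "\<forall>\<^sub>F i in U. coord i Xs = a i"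
    using tuple_with_coords[OF a] by (rule bexE)
  then have "\<forall>\<^sub>F i in U. P i (coord i Xs)" using assms by simp
  with bad Xs have "\<forall>\<^sub>F i in U. False" by eventually_elim (use * in simp)
  then show False using eventually_not_iff[of "\<lambda>i. False"] by simp
qed

lemma eval_term_ultraproduct:
  assumes e: "e \<in> nlists k (carrier MU)" and "term_of_lang L k t"
  shows "eval_term MU e t \<in> carrier MU \<and>
    (\<forall>\<^sub>F i in U. (SOME x. x \<in> eval_term MU e t) i = eval_term (M i) (coord i e) t)"
  using assms(2)
proof (induction t)
  case (Var j)
  then have "j < length e" "e ! j \<in> carrier MU"
    using nlistsE_length[OF e] nlistsE_nth_in[OF e] by simp_all
  then show ?case by (simp add: coord_nth)
next
  case (App f ts)
  let ?Xs = "map (eval_term MU e) ts"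
  have f: "f \<in> fun_syms L" and len: "length ts = fun_arity L f" using App.prems by auto
  have ts: "eval_term MU e t \<in> carrier MU"
    "\<forall>\<^sub>F i in U. (SOME x. x \<in> eval_term MU e t) i = eval_term (M i) (coord i e) t" if "t \<in> set ts" for t
    using App.IH[OF that] App.prems that by simp_all
  have "?Xs \<in> nlists (fun_arity L f) (carrier MU)"
    by (rule nlistsI) (use ts(1) len in auto)
  then have closed: "fun_interp (M i) f (coord i ?Xs) \<in> carrier (M i)" for i
    using structures[unfolded is_structure_def] f coord_in by blast
  have eval: "eval_term MU e (App f ts) = germ (\<lambda>i. fun_interp (M i) f (coord i ?Xs))"
    by (simp add: ultraproduct_def germ_def coord_def)
  have "\<forall>\<^sub>F i in U. \<forall>t\<in>set ts. (SOME x. x \<in> eval_term MU e t) i = eval_term (M i) (coord i e) t"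
    using ts(2) by (intro eventually_ball_finite) auto
  with representative_germ[OF closed]
  have "\<forall>\<^sub>F i in U. (SOME x. x \<in> eval_term MU e (App f ts)) i = eval_term (M i) (coord i e) (App f ts)"
    unfolding eval
  proof eventually_elim
    case (elim i)
    have "coord i ?Xs = map (eval_term (M i) (coord i e)) ts" using elim(2) by (simp add: coord_def)
    then show ?case using elim(1) by simp
  qed
  then show ?case using germ_in[OF closed] eval by simp
qed

text \<open>The theorem of Los. At a quantifier, a witness in each \<open>M i\<close> gives one in the ultraproduct by
  \<open>eventually_all_tuples\<close> for the negated body; at a negation it is used that \<open>U\<close> is an ultrafilter.\<close>

theorem sat_ultraproduct:
  assumes "formula_of_lang L k \<phi>" "e \<in> nlists k (carrier MU)"
  shows "sat MU e \<phi> \<longleftrightarrow> (\<forall>\<^sub>F i in U. sat (M i) (coord i e) \<phi>)"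
  using assms
proof (induction \<phi> arbitrary: k e)
  case Falsum
  then show ?case using eventually_not_iff[of "\<lambda>i. False"] by simp
next
  case (Eq s t)
  then have s: "eval_term MU e s \<in> carrier MU"
    "\<forall>\<^sub>F i in U. (SOME x. x \<in> eval_term MU e s) i = eval_term (M i) (coord i e) s"
    and t: "eval_term MU e t \<in> carrier MU"
    "\<forall>\<^sub>F i in U. (SOME x. x \<in> eval_term MU e t) i = eval_term (M i) (coord i e) t"
    using eval_term_ultraproduct by auto
  show ?case
  proof
    assume "sat MU e (Eq s t)"
    then have "eval_term MU e s = eval_term MU e t" by simp
    with s(2) t(2) show "\<forall>\<^sub>F i in U. sat (M i) (coord i e) (Eq s t)"
      by (auto elim: eventually_elim2)
  next
    assume "\<forall>\<^sub>F i in U. sat (M i) (coord i e) (Eq s t)"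
    with s(2) t(2)
    have "\<forall>\<^sub>F i in U. (SOME x. x \<in> eval_term MU e s) i = (SOME x. x \<in> eval_term MU e t) i"
      by eventually_elim simp
    then show "sat MU e (Eq s t)" using s(1) t(1) carrier_MU_eqI by simp
  qed
next
  case (Rel r ts)
  let ?Xs = "map (eval_term MU e) ts"
  have "\<forall>\<^sub>F i in U. \<forall>t\<in>set ts. (SOME x. x \<in> eval_term MU e t) i = eval_term (M i) (coord i e) t"
    using Rel eval_term_ultraproduct by (intro eventually_ball_finite) auto
  then have ev: "\<forall>\<^sub>F i in U. coord i ?Xs = map (eval_term (M i) (coord i e)) ts"
    by eventually_elim (simp add: coord_def)
  have "sat MU e (Rel r ts) \<longleftrightarrow> (\<forall>\<^sub>F i in U. rel_interp (M i) r (coord i ?Xs))"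
    by (simp add: ultraproduct_def coord_def)
  also have "\<dots> \<longleftrightarrow> (\<forall>\<^sub>F i in U. sat (M i) (coord i e) (Rel r ts))"
    by (rule eventually_cong[OF ev]) simp
  finally show ?case .
next
  case (Neg \<phi>)
  then show ?case by (simp add: eventually_not_iff)
next
  case (Conj \<phi> \<psi>)
  then show ?case by (auto simp: eventually_conj_iff)
next
  case (Exists \<phi>)
  have IH: "sat MU (X # e) \<phi> \<longleftrightarrow> (\<forall>\<^sub>F i in U. sat (M i) ((SOME x. x \<in> X) i # coord i e) \<phi>)"
    if "X \<in> carrier MU" for X
    using Exists.IH[of "Suc k" "X # e"] Exists.prems that by simp
  show ?case
  proof
    assume "sat MU e (Exists \<phi>)"
    then obtain X where X: "X \<in> carrier MU" "\<forall>\<^sub>F i in U. sat (M i) ((SOME x. x \<in> X) i # coord i e) \<phi>"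
      using IH by auto
    from X(2) show "\<forall>\<^sub>F i in U. sat (M i) (coord i e) (Exists \<phi>)"
      by eventually_elim (use X(1) representative_carrier in auto)
  next
    assume ev: "\<forall>\<^sub>F i in U. sat (M i) (coord i e) (Exists \<phi>)"
    have "\<forall>\<^sub>F i in U. \<forall>a\<in>nlists 1 (carrier (M i)). \<not> sat (M i) (a @ coord i e) \<phi>"
      if "\<not> sat MU e (Exists \<phi>)"
    proof (rule eventually_all_tuples)
      fix Xs assume "Xs \<in> nlists 1 (carrier MU)"
      then obtain X where "Xs = [X]" "X \<in> carrier MU" by (auto simp: in_nlists_Suc_iff)
      then show "\<forall>\<^sub>F i in U. \<not> sat (M i) (coord i Xs @ coord i e) \<phi>"
        using that IH by (simp add: eventually_not_iff)
    qed
    then show "sat MU e (Exists \<phi>)"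
      using ev eventually_not_iff[of "\<lambda>i. sat (M i) (coord i e) (Exists \<phi>)"]
      by (auto simp: nlists_Suc)
  qed
qed

section \<open>Internal sets\<close>

text \<open>The internal sets include the definable ones and have the advantage that the counting
  arguments need no formulas for intermediate sets.\<close>

definition internal_set :: "nat \<Rightarrow> ('i \<Rightarrow> 'a list set) \<Rightarrow> ('i \<Rightarrow> 'a) set list set" where
  "internal_set n A = {Xs \<in> nlists n (carrier MU). \<forall>\<^sub>F i in U. coord i Xs \<in> A i}"

definition tuples :: "nat \<Rightarrow> ('i \<Rightarrow> 'a list set) set" where
  "tuples n = {A. \<forall>i. A i \<subseteq> nlists n (carrier (M i))}"

lemma internal_set_in: "internal_set n A \<subseteq> nlists n (carrier MU)"
  by (simp add: internal_set_def)

lemma eventually_Ball_internal: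
  assumes A: "A \<in> tuples n" and P: "\<And>Xs. Xs \<in> internal_set n A \<Longrightarrow> \<forall>\<^sub>F i in U. P i (coord i Xs)"
  shows "\<forall>\<^sub>F i in U. \<forall>a\<in>A i. P i a"
proof -
  have "\<forall>\<^sub>F i in U. \<forall>a\<in>nlists n (carrier (M i)). a \<in> A i \<longrightarrow> P i a"
  proof (rule eventually_all_tuples)
    fix Xs assume Xs: "Xs \<in> nlists n (carrier MU)"
    show "\<forall>\<^sub>F i in U. coord i Xs \<in> A i \<longrightarrow> P i (coord i Xs)"
      by (rule eventually_impI) (use P Xs in \<open>simp add: internal_set_def\<close>)
  qed
  then show ?thesis by (rule eventually_mono) (use A in \<open>auto simp: tuples_def\<close>)
qed

lemma internal_set_subset_iff:
  assumes "A \<in> tuples n"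
  shows "internal_set n A \<subseteq> internal_set n B \<longleftrightarrow> (\<forall>\<^sub>F i in U. A i \<subseteq> B i)"
proof
  assume "internal_set n A \<subseteq> internal_set n B"
  then have "\<forall>\<^sub>F i in U. \<forall>a\<in>A i. a \<in> B i"
    by (intro eventually_Ball_internal[OF assms]) (auto simp: internal_set_def)
  then show "\<forall>\<^sub>F i in U. A i \<subseteq> B i" by (rule eventually_mono) auto
next
  assume *: "\<forall>\<^sub>F i in U. A i \<subseteq> B i"
  show "internal_set n A \<subseteq> internal_set n B"
  proof
    fix Xs assume "Xs \<in> internal_set n A"
    then have Xs: "Xs \<in> nlists n (carrier MU)" "\<forall>\<^sub>F i in U. coord i Xs \<in> A i"
      unfolding internal_set_def by blast+
    from Xs(2) * have "\<forall>\<^sub>F i in U. coord i Xs \<in> B i" by eventually_elim blast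
    with Xs(1) show "Xs \<in> internal_set n B" unfolding internal_set_def by blast
  qed
qed

lemma internal_set_eq_iff:
  assumes "A \<in> tuples n" "B \<in> tuples n"
  shows "internal_set n A = internal_set n B \<longleftrightarrow> (\<forall>\<^sub>F i in U. A i = B i)"
  unfolding set_eq_subset internal_set_subset_iff[OF assms(1)] internal_set_subset_iff[OF assms(2)]
  by (simp add: eventually_conj_iff)

lemma internal_set_empty: "internal_set n (\<lambda>i. {}) = {}"
  using eventually_not_iff[of "\<lambda>i. False"] by (simp add: internal_set_def)

lemma internal_set_Un: "internal_set n A \<union> internal_set n B = internal_set n (\<lambda>i. A i \<union> B i)"
  by (auto simp: internal_set_def eventually_disj_iff)

lemma internal_set_Int: "internal_set n A \<inter> internal_set n B = internal_set n (\<lambda>i. A i \<inter> B i)"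
  by (auto simp: internal_set_def eventually_conj_iff)

lemma solutions_ultraproduct:
  assumes "formula_of_lang L (n + m) \<phi>" "b \<in> nlists m (carrier MU)"
  shows "solutions MU n \<phi> b = internal_set n (\<lambda>i. solutions (M i) n \<phi> (coord i b))"
proof -
  have "sat MU (Xs @ b) \<phi> \<longleftrightarrow> (\<forall>\<^sub>F i in U. coord i Xs \<in> solutions (M i) n \<phi> (coord i b))"
    if "Xs \<in> nlists n (carrier MU)" for Xs
    unfolding sat_ultraproduct[OF assms(1) nlists_appendI[OF that assms(2)]]
    by (simp add: solutions_def coord_in[OF that])
  then show ?thesis unfolding solutions_def[of MU] internal_set_def by (intro Collect_cong conj_cong refl)
qed

lemma solutions_in_tuples: "(\<lambda>i. solutions (M i) n \<phi> (b i)) \<in> tuples n"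
  by (auto simp: tuples_def solutions_def)

lemma definable_internal:
  assumes "X \<in> definable L MU n" shows "\<exists>A\<in>tuples n. X = internal_set n A"
proof -
  obtain m \<phi> b where "formula_of_lang L (n + m) \<phi>" "b \<in> nlists m (carrier MU)"
    and "X = solutions MU n \<phi> b"
    using assms unfolding definable_def mem_Collect_eq by (elim exE conjE) (rule that)
  then have "X = internal_set n (\<lambda>i. solutions (M i) n \<phi> (coord i b))"
    using solutions_ultraproduct by simp
  then show ?thesis using solutions_in_tuples by (rule bexI)
qed

lemma eventually_inj_on_coord:
  assumes "finite X" "X \<subseteq> nlists n (carrier MU)"
  shows "\<forall>\<^sub>F i in U. inj_on (coord i) X"
proof -
  have "\<forall>\<^sub>F i in U. \<forall>x\<in>X. \<forall>y\<in>X. coord i x = coord i y \<longrightarrow> x = y"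
  proof (intro eventually_ball_finite ballI assms(1))
    fix x y assume "x \<in> X" "y \<in> X"
    then have "x \<in> nlists n (carrier MU)" "y \<in> nlists n (carrier MU)" using assms(2) by blast+
    from tuple_eqI[OF this] show "\<forall>\<^sub>F i in U. coord i x = coord i y \<longrightarrow> x = y"
      by (intro eventually_impI) simp
  qed
  then show ?thesis by (rule eventually_mono) (auto simp: inj_on_def)
qed

lemma finite_internal_set_card:
  assumes A: "A \<in> tuples n" and fin: "finite (internal_set n A)"
  shows "\<forall>\<^sub>F i in U. card (A i) = card (internal_set n A)"
proof -
  let ?X = "internal_set n A"
  have "\<forall>\<^sub>F i in U. inj_on (coord i) ?X"
    by (rule eventually_inj_on_coord[OF fin internal_set_in])
  moreover have "\<forall>\<^sub>F i in U. \<forall>x\<in>?X. coord i x \<in> A i"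
    using fin by (intro eventually_ball_finite) (auto simp: internal_set_def)
  moreover have "\<forall>\<^sub>F i in U. \<forall>a\<in>A i. a \<in> coord i ` ?X"
    by (rule eventually_Ball_internal[OF A]) simp
  ultimately show ?thesis
  proof eventually_elim
    case (elim i)
    then have "A i = coord i ` ?X" by auto
    then show ?case using elim(1) by (simp add: card_image)
  qed
qed

text \<open>Finitely many distinct elements of the ultraproduct have distinct coordinates along \<open>U\<close>. Hence
  an asymptotic estimate that holds for large members only is available along \<open>U\<close>.\<close>

lemma eventually_card_carrier_gt:
  assumes "infinite (carrier MU)" and fin: "\<And>i. finite (carrier (M i))"
  shows "\<forall>\<^sub>F i in U. q < card (carrier (M i))"
proof -
  obtain B where B: "B \<subseteq> carrier MU" "card B = Suc q" "finite B"
    using infinite_arbitrarily_large[OF assms(1)] by blast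
  have "\<forall>\<^sub>F i in U. inj_on (coord i) ((\<lambda>x. [x]) ` B)"
    using B by (intro eventually_inj_on_coord[of _ 1]) auto
  then show ?thesis
  proof eventually_elim
    case (elim i)
    have "inj_on (\<lambda>X. (SOME x. x \<in> X) i) B" using elim by (auto simp: inj_on_def)
    then have "card B \<le> card (carrier (M i))"
      using B fin representative_carrier by (intro card_inj_on_le) auto
    then show ?case using B by simp
  qed
qed

end

section \<open>Counting quantifiers\<close>

fun rename_term :: "(nat \<Rightarrow> nat) \<Rightarrow> 'f fo_term \<Rightarrow> 'f fo_term" where
  "rename_term r (Var i) = Var (r i)"
| "rename_term r (App f ts) = App f (map (rename_term r) ts)"

fun rename :: "(nat \<Rightarrow> nat) \<Rightarrow> ('f, 'r) formula \<Rightarrow> ('f, 'r) formula" where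
  "rename r Falsum = Falsum"
| "rename r (Eq s t) = Eq (rename_term r s) (rename_term r t)"
| "rename r (Rel q ts) = Rel q (map (rename_term r) ts)"
| "rename r (Neg \<phi>) = Neg (rename r \<phi>)"
| "rename r (Conj \<phi> \<psi>) = Conj (rename r \<phi>) (rename r \<psi>)"
| "rename r (Exists \<phi>) = Exists (rename (case_nat 0 (\<lambda>i. Suc (r i))) \<phi>)"

lemma term_of_lang_rename:
  "\<lbrakk>term_of_lang L k t; \<And>i. i < k \<Longrightarrow> r i < l\<rbrakk> \<Longrightarrow> term_of_lang L l (rename_term r t)"
  by (induction t) auto

lemma formula_of_lang_rename:
  "\<lbrakk>formula_of_lang L k \<phi>; \<And>i. i < k \<Longrightarrow> r i < l\<rbrakk> \<Longrightarrow> formula_of_lang L l (rename r \<phi>)"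
proof (induction \<phi> arbitrary: k l r)
  case (Exists \<phi>)
  have "case_nat 0 (\<lambda>i. Suc (r i)) i < Suc l" if "i < Suc k" for i
    using that Exists.prems(2) by (cases i) auto
  then show ?case using Exists.IH[of "Suc k"] Exists.prems(1) by simp
qed (auto intro: term_of_lang_rename)

lemma eval_term_rename:
  "\<lbrakk>term_of_lang L k t; \<And>i. i < k \<Longrightarrow> e' ! r i = e ! i\<rbrakk> \<Longrightarrow>
   eval_term M e' (rename_term r t) = eval_term M e t"
  by (induction t) (auto intro!: arg_cong[of _ _ "fun_interp M _"])

lemma sat_rename:
  "\<lbrakk>formula_of_lang L k \<phi>; \<And>i. i < k \<Longrightarrow> e' ! r i = e ! i\<rbrakk> \<Longrightarrow>
   sat M e' (rename r \<phi>) \<longleftrightarrow> sat M e \<phi>"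
proof (induction \<phi> arbitrary: k r e e')
  case (Eq s t)
  then show ?case by (simp add: eval_term_rename[where L = L and k = k and e = e])
next
  case (Rel q ts)
  then have "map (eval_term M e') (map (rename_term r) ts) = map (eval_term M e) ts"
    by (auto simp: eval_term_rename[where L = L and k = k and e = e])
  then show ?case by (simp only: rename.simps sat.simps)
next
  case (Conj \<phi> \<psi>)
  then show ?case using Conj.IH[of k e' r e] by simp
next
  case (Exists \<phi>)
  have "(a # e') ! case_nat 0 (\<lambda>i. Suc (r i)) i = (a # e) ! i" if "i < Suc k" for i a
    using that Exists.prems(2) by (cases i) auto
  then show ?case using Exists.IH[of "Suc k"] Exists.prems(1) by simp
qed auto

lemma formula_of_lang_Exists_funpow:
  "formula_of_lang L k ((Exists ^^ n) \<phi>) \<longleftrightarrow> formula_of_lang L (n + k) \<phi>"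
  by (induction n arbitrary: k) auto

lemma sat_Exists_funpow:
  "sat M e ((Exists ^^ n) \<phi>) \<longleftrightarrow> (\<exists>a\<in>nlists n (carrier M). sat M (a @ e) \<phi>)"
proof (induction n arbitrary: \<phi>)
  case (Suc n)
  have "sat M e ((Exists ^^ Suc n) \<phi>) \<longleftrightarrow>
      (\<exists>a\<in>nlists n (carrier M). \<exists>x\<in>carrier M. sat M ((x # a) @ e) \<phi>)"
    unfolding funpow_Suc_right o_apply Suc.IH by simp
  also have "\<dots> \<longleftrightarrow> (\<exists>a\<in>nlists (Suc n) (carrier M). sat M (a @ e) \<phi>)"
    unfolding nlists_Suc by blast
  finally show ?case .
qed simp

text \<open>The two tuples are the variables \<open>0, \<dots>, n - 1\<close> and \<open>n, \<dots>, 2 * n - 1\<close>.\<close>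

definition distinct_tuples :: "nat \<Rightarrow> ('f, 'r) formula" where
  "distinct_tuples n = Neg (foldr (\<lambda>i. Conj (Eq (Var i) (Var (n + i)))) [0..<n] (Neg Falsum))"

lemma formula_of_lang_foldr_Conj:
  "formula_of_lang L k (foldr (\<lambda>i. Conj (\<psi> i)) js (Neg Falsum)) \<longleftrightarrow> (\<forall>i\<in>set js. formula_of_lang L k (\<psi> i))"
  by (induction js) auto

lemma sat_foldr_Conj:
  "sat M e (foldr (\<lambda>i. Conj (\<psi> i)) js (Neg Falsum)) \<longleftrightarrow> (\<forall>i\<in>set js. sat M e (\<psi> i))"
  by (induction js) auto

lemma formula_of_lang_distinct_tuples: "formula_of_lang L (n + (n + k)) (distinct_tuples n)"
  by (simp add: distinct_tuples_def formula_of_lang_foldr_Conj)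

lemma sat_distinct_tuples:
  assumes "length a = n" "length b = n"
  shows "sat M (a @ b @ e) (distinct_tuples n) \<longleftrightarrow> a \<noteq> b"
proof -
  have "(a @ b @ e) ! i = a ! i \<and> (a @ b @ e) ! (n + i) = b ! i" if "i < n" for i
    using that assms by (simp add: nth_append)
  then have "sat M (a @ b @ e) (distinct_tuples n) \<longleftrightarrow> \<not> (\<forall>i<n. a ! i = b ! i)"
    by (auto simp: distinct_tuples_def sat_foldr_Conj)
  moreover have "a = b \<longleftrightarrow> (\<forall>i<n. a ! i = b ! i)" using assms list_eq_iff_nth_eq[of a b] by simp
  ultimately show ?thesis by blast
qed

text \<open>At least \<open>q + 1\<close> solutions exist iff there is a solution \<open>z\<close> from which at least \<open>q\<close> solutions
  differ. In the formula for the latter the variables of \<open>z\<close> stand right after the tuple that is counted, so the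
  parameters of \<open>\<phi>\<close> are shifted by \<open>n\<close>.\<close>

fun at_least :: "nat \<Rightarrow> nat \<Rightarrow> ('f, 'r) formula \<Rightarrow> ('f, 'r) formula" where
  "at_least n 0 \<phi> = Neg Falsum"
| "at_least n (Suc q) \<phi> = (Exists ^^ n) (Conj \<phi> (at_least n q
     (Conj (rename (\<lambda>i. if i < n then i else n + i) \<phi>) (distinct_tuples n))))"

lemma formula_of_lang_at_least:
  "formula_of_lang L (n + k) \<phi> \<Longrightarrow> formula_of_lang L k (at_least n q \<phi>)"
proof (induction q arbitrary: \<phi> k)
  case (Suc q)
  have "formula_of_lang L (n + (n + k)) (rename (\<lambda>i. if i < n then i else n + i) \<phi>)"
    using Suc.prems by (rule formula_of_lang_rename) auto
  then show ?case
    using Suc by (simp add: formula_of_lang_Exists_funpow formula_of_lang_distinct_tuples)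
qed simp

lemma finite_nlists: "finite A \<Longrightarrow> finite (nlists n A)"
  by (induction n) (auto simp: nlists_Suc)

lemma finite_solutions: "finite (carrier M) \<Longrightarrow> finite (solutions M n \<phi> b)"
  unfolding solutions_def by (rule finite_subset[OF _ finite_nlists]) auto

lemma sat_at_least:
  assumes fin: "finite (carrier M)"
  shows "\<lbrakk>formula_of_lang L (n + k) \<phi>; length e = k\<rbrakk> \<Longrightarrow>
    sat M e (at_least n q \<phi>) \<longleftrightarrow> q \<le> card (solutions M n \<phi> e)"
proof (induction q arbitrary: \<phi> e k)
  case (Suc q)
  let ?\<phi>' = "Conj (rename (\<lambda>i. if i < n then i else n + i) \<phi>) (distinct_tuples n)"
  let ?S = "solutions M n \<phi> e"
  have lang: "formula_of_lang L (n + (n + k)) ?\<phi>'"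
    using formula_of_lang_rename[OF Suc.prems(1), of "\<lambda>i. if i < n then i else n + i" "n + (n + k)"]
    by (simp add: formula_of_lang_distinct_tuples)
  have remove: "solutions M n ?\<phi>' (a @ e) = ?S - {a}" if a: "length a = n" for a
  proof -
    have "sat M (x @ a @ e) ?\<phi>' \<longleftrightarrow> sat M (x @ e) \<phi> \<and> x \<noteq> a" if "length x = n" for x
    proof -
      have "sat M (x @ a @ e) (rename (\<lambda>i. if i < n then i else n + i) \<phi>) \<longleftrightarrow> sat M (x @ e) \<phi>"
        by (rule sat_rename[OF Suc.prems(1)]) (use a that in \<open>auto simp: nth_append\<close>)
      then show ?thesis by (simp add: sat_distinct_tuples[OF that a])
    qed
    then show ?thesis unfolding solutions_def using nlistsE_length by blast
  qed
  have "sat M e (at_least n (Suc q) \<phi>) \<longleftrightarrow>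
      (\<exists>a\<in>nlists n (carrier M). sat M (a @ e) \<phi> \<and> sat M (a @ e) (at_least n q ?\<phi>'))"
    by (simp add: sat_Exists_funpow)
  also have "\<dots> \<longleftrightarrow> (\<exists>a\<in>?S. sat M (a @ e) (at_least n q ?\<phi>'))"
    unfolding solutions_def by blast
  also have "\<dots> \<longleftrightarrow> (\<exists>a\<in>?S. q \<le> card (?S - {a}))"
  proof (rule bex_cong[OF refl])
    fix a assume "a \<in> ?S"
    then have a: "length a = n" unfolding solutions_def using nlistsE_length by blast
    have "length (a @ e) = n + k" using a Suc.prems(2) by simp
    from Suc.IH[OF lang this] show "sat M (a @ e) (at_least n q ?\<phi>') \<longleftrightarrow> q \<le> card (?S - {a})"
      unfolding remove[OF a] .
  qed
  also have "\<dots> \<longleftrightarrow> Suc q \<le> card ?S"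
  proof -
    have "card (?S - {a}) = card ?S - 1" if "a \<in> ?S" for a using that by (rule card_Diff_singleton)
    then have "(\<exists>a\<in>?S. q \<le> card (?S - {a})) \<longleftrightarrow> ?S \<noteq> {} \<and> q \<le> card ?S - 1" by auto
    then show ?thesis using finite_solutions[OF fin, of n \<phi> e] by (auto simp: card_eq_0_iff Suc_le_eq)
  qed
  finally show ?case .
qed simp

section \<open>Level sets\<close>

lemma definable0_Union:
  assumes "finite \<Phi>" "\<And>\<phi>. \<phi> \<in> \<Phi> \<Longrightarrow> formula_of_lang L m \<phi>"
  shows "(\<Union>\<phi>\<in>\<Phi>. solutions M m \<phi> []) \<in> definable0 L M m"
proof -
  have "\<exists>\<psi>. formula_of_lang L m \<psi> \<and> solutions M m \<psi> [] = (\<Union>\<phi>\<in>\<Phi>. solutions M m \<phi> [])"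
    using assms
  proof (induction \<Phi>)
    case empty
    have "solutions M m Falsum [] = {}" by (simp add: solutions_def)
    then show ?case by (intro exI[of _ Falsum]) simp
  next
    case (insert \<phi> \<Phi>)
    then obtain \<psi> where \<psi>: "formula_of_lang L m \<psi>" "solutions M m \<psi> [] = (\<Union>\<phi>\<in>\<Phi>. solutions M m \<phi> [])"
      by auto
    have "solutions M m (Neg (Conj (Neg \<phi>) (Neg \<psi>))) [] = solutions M m \<phi> [] \<union> solutions M m \<psi> []"
      unfolding solutions_def by auto
    then show ?case
      using insert.prems \<psi> by (intro exI[of _ "Neg (Conj (Neg \<phi>) (Neg \<psi>))"]) simp
  qed
  then obtain \<psi> where "formula_of_lang L m \<psi>" "solutions M m \<psi> [] = (\<Union>\<phi>\<in>\<Phi>. solutions M m \<phi> [])"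
    by blast
  then show ?thesis unfolding definable0_def by (metis (mono_tags, lifting) mem_Collect_eq)
qed

text \<open>Since \<open>g\<close> is constant on each member of the cover, a level set is the union of the members that
  meet it.\<close>

lemma definable_level_sets:
  assumes \<Phi>: "finite \<Phi>" "\<And>\<phi>. \<phi> \<in> \<Phi> \<Longrightarrow> formula_of_lang L m \<phi>"
    and cover: "\<And>b. b \<in> nlists m (carrier M) \<Longrightarrow> \<exists>\<phi>\<in>\<Phi>. b \<in> solutions M m \<phi> []"
    and const: "\<And>\<phi> b b'. \<lbrakk>\<phi> \<in> \<Phi>; b \<in> solutions M m \<phi> []; b' \<in> solutions M m \<phi> []\<rbrakk> \<Longrightarrow> g b = g b'"
  shows "finite (g ` nlists m (carrier M))"
    and "{b \<in> nlists m (carrier M). g b = f} \<in> definable0 L M m"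
proof -
  have "g ` nlists m (carrier M) \<subseteq> (\<lambda>\<phi>. g (SOME b. b \<in> solutions M m \<phi> [])) ` \<Phi>"
  proof
    fix y assume "y \<in> g ` nlists m (carrier M)"
    then obtain b where b: "b \<in> nlists m (carrier M)" "y = g b" by (rule imageE)
    obtain \<phi> where \<phi>: "\<phi> \<in> \<Phi>" "b \<in> solutions M m \<phi> []" using cover[OF b(1)] by (rule bexE)
    have "(SOME b. b \<in> solutions M m \<phi> []) \<in> solutions M m \<phi> []" using \<phi>(2) by (rule someI)
    from const[OF \<phi>(1) \<phi>(2) this] show "y \<in> (\<lambda>\<phi>. g (SOME b. b \<in> solutions M m \<phi> [])) ` \<Phi>"
      using \<phi>(1) b(2) by simp
  qed
  then show "finite (g ` nlists m (carrier M))" using \<Phi>(1) finite_surj by blast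
  let ?\<Psi> = "{\<phi> \<in> \<Phi>. \<exists>b\<in>solutions M m \<phi> []. g b = f}"
  have "{b \<in> nlists m (carrier M). g b = f} = (\<Union>\<phi>\<in>?\<Psi>. solutions M m \<phi> [])"
  proof (intro equalityI subsetI)
    fix b assume "b \<in> {b \<in> nlists m (carrier M). g b = f}"
    then show "b \<in> (\<Union>\<phi>\<in>?\<Psi>. solutions M m \<phi> [])" using cover[of b] by blast
  next
    fix b assume "b \<in> (\<Union>\<phi>\<in>?\<Psi>. solutions M m \<phi> [])"
    then obtain \<phi> b' where "\<phi> \<in> \<Phi>" "b \<in> solutions M m \<phi> []" "b' \<in> solutions M m \<phi> []" "g b' = f"
      by blast
    then have "g b = f" "b \<in> nlists m (carrier M)"
      using const[of \<phi> b b'] by (simp_all add: solutions_def)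
    then show "b \<in> {b \<in> nlists m (carrier M). g b = f}" by blast
  qed
  then show "{b \<in> nlists m (carrier M). g b = f} \<in> definable0 L M m"
    using definable0_Union[of ?\<Psi> L m M] \<Phi> by simp
qed

text \<open>In a finite structure there are finitely many possible numbers of solutions, each of which is
  expressed by a counting formula.\<close>

lemma definable_level_sets_finite:
  assumes fin: "finite (carrier M)" and \<phi>: "formula_of_lang L (n + m) \<phi>"
    and g: "\<And>b b'. \<lbrakk>b \<in> nlists m (carrier M); b' \<in> nlists m (carrier M);
      card (solutions M n \<phi> b) = card (solutions M n \<phi> b')\<rbrakk> \<Longrightarrow> g b = g b'"
  shows "finite (g ` nlists m (carrier M))"
    and "{b \<in> nlists m (carrier M). g b = f} \<in> definable0 L M m"
proof -
  let ?exactly = "\<lambda>q. Conj (at_least n q \<phi>) (Neg (at_least n (Suc q) \<phi>))"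
  let ?\<Phi> = "?exactly ` {..card (nlists n (carrier M))}"
  have sat: "b \<in> solutions M m (?exactly q) [] \<longleftrightarrow> b \<in> nlists m (carrier M) \<and> card (solutions M n \<phi> b) = q"
    for b q
  proof (cases "b \<in> nlists m (carrier M)")
    case True
    then have "length b = m" by (rule nlistsE_length)
    from sat_at_least[OF fin \<phi> this, of q] sat_at_least[OF fin \<phi> this, of "Suc q"] True
    show ?thesis unfolding solutions_def[of _ m] by (auto simp del: at_least.simps)
  qed (simp add: solutions_def)
  have \<Phi>: "finite ?\<Phi>" "\<And>\<psi>. \<psi> \<in> ?\<Phi> \<Longrightarrow> formula_of_lang L m \<psi>"
    using formula_of_lang_at_least[OF \<phi>] by (auto simp del: at_least.simps)
  have cover: "\<exists>\<psi>\<in>?\<Phi>. b \<in> solutions M m \<psi> []" if "b \<in> nlists m (carrier M)" for b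
  proof (rule bexI)
    show "b \<in> solutions M m (?exactly (card (solutions M n \<phi> b))) []" using that sat by blast
    have "card (solutions M n \<phi> b) \<le> card (nlists n (carrier M))"
      using finite_nlists[OF fin] by (rule card_mono) (simp add: solutions_def)
    then show "?exactly (card (solutions M n \<phi> b)) \<in> ?\<Phi>" by blast
  qed
  have const: "g b = g b'"
    if \<psi>: "\<psi> \<in> ?\<Phi>" and b: "b \<in> solutions M m \<psi> []" "b' \<in> solutions M m \<psi> []" for \<psi> b b'
  proof -
    obtain q where q: "\<psi> = ?exactly q" using \<psi> by blast
    show ?thesis using b g[of b b'] unfolding q sat by simp
  qed
  show "finite (g ` nlists m (carrier M))" "{b \<in> nlists m (carrier M). g b = f} \<in> definable0 L M m"
    using definable_level_sets[where g = g and M = M, OF \<Phi> cover const] by simp_all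
qed

section \<open>The counting measure\<close>

locale pseudofinite_counting = ultraproduct_structure L U M + tolerance U E
  for L :: "('f, 'r) language" and U :: "'i filter"
    and M :: "'i \<Rightarrow> ('f, 'r, 'a) fo_structure" and E :: "real set" +
  assumes finite_carrier: "finite (carrier (M i))"
begin

text \<open>The choice of \<open>A\<close> matters only off a set of the ultrafilter, see \<open>count_internal_set\<close>. The dimension
  \<open>n\<close> is determined by the set except for the empty set, whose count vanishes in every dimension.\<close>

definition count :: "('i \<Rightarrow> 'a) set list set \<Rightarrow> 'i \<Rightarrow> real" where
  "count X = (SOME c. \<exists>n. \<exists>A\<in>tuples n. X = internal_set n A \<and> c = (\<lambda>i. real (card (A i))))"

definition counting_measure :: "('i \<Rightarrow> 'a) set list set \<Rightarrow> 'i \<Rightarrow> real" where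
  "counting_measure X = nf (leq_along U E) (count X)"

lemma count_internal_set:
  assumes A: "A \<in> tuples n"
  shows "\<forall>\<^sub>F i in U. count (internal_set n A) i = real (card (A i))"
proof -
  let ?R = "\<lambda>c. \<exists>k. \<exists>B\<in>tuples k. internal_set n A = internal_set k B \<and> c = (\<lambda>i. real (card (B i)))"
  have "?R (\<lambda>i. real (card (A i)))" by (rule exI, rule bexI[OF _ A]) simp
  then have "?R (count (internal_set n A))" unfolding count_def by (rule someI[of ?R])
  then obtain k B where B: "B \<in> tuples k" and eq: "internal_set n A = internal_set k B"
    and c: "count (internal_set n A) = (\<lambda>i. real (card (B i)))"
    by blast
  have "\<forall>\<^sub>F i in U. card (A i) = card (B i)"
  proof (cases "n = k")
    case True
    then have "\<forall>\<^sub>F i in U. A i = B i" using A B eq internal_set_eq_iff by simp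
    then show ?thesis by (rule eventually_mono) simp
  next
    case False
    have "length x = l" if "x \<in> internal_set l D" for x l D
      by (rule nlistsE_length[OF subsetD[OF internal_set_in that]])
    then have "n = k" if "x \<in> internal_set n A" for x
      using that eq by metis
    then have "internal_set n A = {}" "internal_set k B = {}" using False eq by auto
    moreover have empty: "(\<lambda>i. {}) \<in> tuples l" for l by (simp add: tuples_def)
    ultimately have "\<forall>\<^sub>F i in U. A i = {}" "\<forall>\<^sub>F i in U. B i = {}"
      using internal_set_eq_iff[OF A empty] internal_set_eq_iff[OF B empty]
      by (simp_all add: internal_set_empty)
    then show ?thesis by eventually_elim simp
  qed
  then show ?thesis unfolding c by (rule eventually_mono) simp
qed

lemma nf_eventually_cong:
  assumes "\<forall>\<^sub>F i in U. s i = t i" "t \<in> nonneg_along U"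
  shows "nf (leq_along U E) s = nf (leq_along U E) t"
proof -
  have "\<forall>\<^sub>F i in U. 0 \<le> s i"
    using assms(1) assms(2)[unfolded nonneg_along_def mem_Collect_eq] by eventually_elim simp
  then have s: "s \<in> nonneg_along U" by (simp add: nonneg_along_def)
  have "\<forall>\<^sub>F i in U. s i \<le> t i" "\<forall>\<^sub>F i in U. t i \<le> s i"
    using assms(1) by (auto elim: eventually_mono)
  then have "equivalent s t" unfolding equivalent_def using leq_along_pointwise s assms(2) by blast
  with s assms(2) show ?thesis by (rule nf_eqI)
qed

lemma real_sequence_nonneg [simp]: "(\<lambda>i. real (c i)) \<in> nonneg_along U"
  by (simp add: nonneg_along_def)

lemma counting_measure_internal_set:
  "A \<in> tuples n \<Longrightarrow> counting_measure (internal_set n A) = nf (leq_along U E) (\<lambda>i. real (card (A i)))"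
  unfolding counting_measure_def by (rule nf_eventually_cong[OF count_internal_set]) simp_all

lemma finite_tuples: "A \<in> tuples n \<Longrightarrow> finite (A i)"
  unfolding tuples_def using finite_nlists[OF finite_carrier] finite_subset by blast

lemma counting_measure_finite:
  assumes "X \<in> Def L MU" "finite X"
  shows "counting_measure X = [card X] \<cdot>\<^bsub>Q\<^esub> \<one>\<^bsub>Q\<^esub>"
proof -
  obtain n where "X \<in> definable L MU n" using assms(1) unfolding Def_def by (rule UN_E)
  then obtain A where A: "A \<in> tuples n" "X = internal_set n A" using definable_internal by blast
  have "[card X] \<cdot>\<^bsub>Q\<^esub> \<one>\<^bsub>Q\<^esub> = nf (leq_along U E) (of_nat (card X))"
    using add_pow_order_quotient[of 1 "card X"] by simp
  also have "\<dots> = counting_measure X"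
    unfolding A(2) counting_measure_internal_set[OF A(1)]
  proof (rule nf_eventually_cong)
    show "\<forall>\<^sub>F i in U. of_nat (card (internal_set n A)) i = real (card (A i))"
      using finite_internal_set_card[OF A(1)] assms(2) A(2)
      by (auto simp: of_nat_fun elim: eventually_mono)
  qed simp
  finally show ?thesis by simp
qed

lemma counting_measure_Un:
  assumes "A \<in> tuples n" "B \<in> tuples n" "internal_set n A \<inter> internal_set n B = {}"
  shows "counting_measure (internal_set n A \<union> internal_set n B) =
    counting_measure (internal_set n A) \<oplus>\<^bsub>Q\<^esub> counting_measure (internal_set n B)"
proof -
  have Un: "(\<lambda>i. A i \<union> B i) \<in> tuples n" and Int: "(\<lambda>i. A i \<inter> B i) \<in> tuples n"
    and empty: "(\<lambda>i. {}) \<in> tuples n"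
    using assms(1,2) by (auto simp: tuples_def)
  have "internal_set n (\<lambda>i. A i \<inter> B i) = internal_set n (\<lambda>i. {})"
    using assms(3) by (simp add: internal_set_Int internal_set_empty)
  then have "\<forall>\<^sub>F i in U. A i \<inter> B i = {}" using internal_set_eq_iff[OF Int empty] by simp
  then have "\<forall>\<^sub>F i in U. real (card (A i \<union> B i)) = ((\<lambda>i. real (card (A i))) + (\<lambda>i. real (card (B i)))) i"
    by eventually_elim (simp add: card_Un_disjoint finite_tuples[OF assms(1)] finite_tuples[OF assms(2)])
  then have "nf (leq_along U E) (\<lambda>i. real (card (A i \<union> B i))) =
      nf (leq_along U E) ((\<lambda>i. real (card (A i))) + (\<lambda>i. real (card (B i))))"
    by (rule nf_eventually_cong[OF _ add_in]) simp_all
  then show ?thesis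
    unfolding internal_set_Un counting_measure_internal_set[OF Un]
      counting_measure_internal_set[OF assms(1)] counting_measure_internal_set[OF assms(2)]
    by simp
qed

text \<open>By transfer, the graph of \<open>p\<close> is along \<open>U\<close> the graph of a map from \<open>A i\<close> to \<open>B i\<close>, and its fibres have
  size \<open>f i\<close> up to the factor \<open>1 + \<epsilon>\<close>, for all points of \<open>B i\<close> at once. Summing over \<open>B i\<close> keeps this relative
  error.\<close>

lemma counting_measure_fibres:
  assumes A: "A \<in> tuples n" and B: "B \<in> tuples k" and G: "G \<in> tuples (n + k)"
    and p: "p \<in> internal_set n A \<rightarrow> internal_set k B"
    and graph: "(\<lambda>x. x @ p x) ` internal_set n A = internal_set (n + k) G"
    and f: "f \<in> carrier Q"
    and fibre: "\<And>y. y \<in> internal_set k B \<Longrightarrow> counting_measure {x \<in> internal_set n A. p x = y} = f"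
  shows "counting_measure (internal_set n A) = f \<otimes>\<^bsub>Q\<^esub> counting_measure (internal_set k B)"
proof -
  let ?X = "internal_set n A" and ?Y = "internal_set k B"
  define Fib where "Fib = (\<lambda>i y. {x \<in> A i. x @ y \<in> G i})"
  have f_nonneg: "f \<in> nonneg_along U" and f_nf: "nf (leq_along U E) f = f"
    using f by (auto simp: carrier_order_quotient)
  have graph_iff: "p x = y \<longleftrightarrow> (\<forall>\<^sub>F i in U. coord i x @ coord i y \<in> G i)"
    if x: "x \<in> ?X" and y: "y \<in> ?Y" for x y
  proof -
    have xy: "x \<in> nlists n (carrier MU)" "y \<in> nlists k (carrier MU)"
      using subsetD[OF internal_set_in x] subsetD[OF internal_set_in y] .
    have "p x = y \<longleftrightarrow> x @ y \<in> (\<lambda>x. x @ p x) ` ?X"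
    proof
      assume "x @ y \<in> (\<lambda>x. x @ p x) ` ?X"
      then obtain x' where x': "x @ y = x' @ p x'" "x' \<in> ?X" by (rule imageE)
      have "length x' = length x"
        using nlistsE_length[OF subsetD[OF internal_set_in x'(2)]] nlistsE_length[OF xy(1)] by simp
      then show "p x = y" using x'(1) by simp
    qed (use x in blast)
    then show ?thesis
      unfolding graph internal_set_def[of "n + k"] using nlists_appendI[OF xy] by simp
  qed
  have Fib: "(\<lambda>i. Fib i (y i)) \<in> tuples n" for y
    using A by (auto simp: tuples_def Fib_def)
  have fibre_eq: "{x \<in> ?X. p x = y} = internal_set n (\<lambda>i. Fib i (coord i y))" if y: "y \<in> ?Y" for y
  proof -
    have "{x \<in> ?X. p x = y} = {x \<in> ?X. \<forall>\<^sub>F i in U. coord i x @ coord i y \<in> G i}"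
      using graph_iff[OF _ y] by blast
    then show ?thesis by (simp add: internal_set_def Fib_def eventually_conj_iff conj_assoc)
  qed
  have total: "\<forall>\<^sub>F i in U. \<forall>x\<in>A i. \<exists>y\<in>B i. x @ y \<in> G i"
  proof (rule eventually_Ball_internal[OF A])
    fix x assume x: "x \<in> ?X"
    then have px: "p x \<in> ?Y" using p by (rule funcset_mem[rotated])
    have "\<forall>\<^sub>F i in U. coord i x @ coord i (p x) \<in> G i" using graph_iff[OF x px] by simp
    moreover have "\<forall>\<^sub>F i in U. coord i (p x) \<in> B i" using px by (simp add: internal_set_def)
    ultimately show "\<forall>\<^sub>F i in U. \<exists>y\<in>B i. coord i x @ y \<in> G i"
      by eventually_elim (rule bexI)
  qed
  have unique: "\<forall>\<^sub>F i in U. \<forall>x\<in>A i. \<forall>y\<in>B i. \<forall>y'\<in>B i. x @ y \<in> G i \<and> x @ y' \<in> G i \<longrightarrow> y = y'"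
  proof (rule eventually_Ball_internal[OF A], rule eventually_Ball_internal[OF B],
      rule eventually_Ball_internal[OF B], rule eventually_impI)
    fix x y y' assume "x \<in> ?X" "y \<in> ?Y" "y' \<in> ?Y"
      and "\<forall>\<^sub>F i in U. coord i x @ coord i y \<in> G i \<and> coord i x @ coord i y' \<in> G i"
    then have "y = y'" using graph_iff[of x y] graph_iff[of x y'] by (simp add: eventually_conj_iff)
    then show "\<forall>\<^sub>F i in U. coord i y = coord i y'" by simp
  qed
  have partition: "\<forall>\<^sub>F i in U. card (A i) = (\<Sum>y\<in>B i. card (Fib i y))"
    using total unique
  proof eventually_elim
    case (elim i)
    have "A i = (\<Union>y\<in>B i. Fib i y)" using elim(1) unfolding Fib_def by blast
    moreover have "card (\<Union>y\<in>B i. Fib i y) = (\<Sum>y\<in>B i. card (Fib i y))"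
    proof (rule card_UN_disjoint)
      show "\<forall>y\<in>B i. \<forall>y'\<in>B i. y \<noteq> y' \<longrightarrow> Fib i y \<inter> Fib i y' = {}"
        using elim(2) unfolding Fib_def by blast
    qed (use finite_tuples[OF B] finite_tuples[OF A] in \<open>auto simp: Fib_def\<close>)
    ultimately show ?case by simp
  qed
  have fibre_size: "equivalent (\<lambda>i. real (card (Fib i (coord i y)))) f" if y: "y \<in> ?Y" for y
  proof -
    have "nf (leq_along U E) (\<lambda>i. real (card (Fib i (coord i y)))) = nf (leq_along U E) f"
      using fibre[OF y] unfolding fibre_eq[OF y] counting_measure_internal_set[OF Fib] f_nf .
    then show ?thesis by (rule iffD1[OF nf_eq_iff[OF real_sequence_nonneg f_nonneg]])
  qed
  have "equivalent (\<lambda>i. real (card (A i))) (f * (\<lambda>i. real (card (B i))))"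
    unfolding equivalent_def leq_along_def
  proof (intro conjI ballI)
    fix \<epsilon> assume \<epsilon>: "\<epsilon> \<in> E"
    have "\<forall>\<^sub>F i in U. \<forall>y\<in>B i. real (card (Fib i y)) \<le> (1 + \<epsilon>) * f i"
      by (rule eventually_Ball_internal[OF B])
        (rule leq_alongD[OF conjunct1[OF fibre_size[unfolded equivalent_def]] \<epsilon>])
    then show "\<forall>\<^sub>F i in U. real (card (A i)) \<le> (1 + \<epsilon>) * (f * (\<lambda>i. real (card (B i)))) i"
      using partition
    proof eventually_elim
      case (elim i)
      have "(\<Sum>y\<in>B i. real (card (Fib i y))) \<le> real (card (B i)) * ((1 + \<epsilon>) * f i)"
        using elim(1) by (intro sum_bounded_above) simp
      then show ?case using elim(2) by (simp add: algebra_simps)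
    qed
    have "\<forall>\<^sub>F i in U. \<forall>y\<in>B i. f i \<le> (1 + \<epsilon>) * real (card (Fib i y))"
      by (rule eventually_Ball_internal[OF B])
        (rule leq_alongD[OF conjunct2[OF fibre_size[unfolded equivalent_def]] \<epsilon>])
    then show "\<forall>\<^sub>F i in U. (f * (\<lambda>i. real (card (B i)))) i \<le> (1 + \<epsilon>) * real (card (A i))"
      using partition
    proof eventually_elim
      case (elim i)
      have "real (card (B i)) * f i \<le> (\<Sum>y\<in>B i. (1 + \<epsilon>) * real (card (Fib i y)))"
        using elim(1) by (intro sum_bounded_below) simp
      then show ?case using elim(2) by (simp add: sum_distrib_left algebra_simps)
    qed
  qed
  then have "nf (leq_along U E) (\<lambda>i. real (card (A i))) =
      nf (leq_along U E) (f * (\<lambda>i. real (card (B i))))"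
    by (intro nf_eqI) (simp_all add: f_nonneg)
  then show ?thesis
    unfolding counting_measure_internal_set[OF A] counting_measure_internal_set[OF B]
    by (simp add: f_nonneg)
qed

definition has_definable_level_sets :: bool where
  "has_definable_level_sets \<longleftrightarrow> (\<forall>n m \<phi>. formula_of_lang L (n + m) \<phi> \<longrightarrow>
     finite ((\<lambda>b. counting_measure (solutions MU n \<phi> b)) ` nlists m (carrier MU)) \<and>
     (\<forall>f. {b \<in> nlists m (carrier MU). counting_measure (solutions MU n \<phi> b) = f} \<in> definable0 L MU m))"

theorem is_measure_counting_measure:
  assumes "has_definable_level_sets"
  shows "is_measure L Q MU counting_measure"
  unfolding is_measure_def Let_def
proof (intro conjI allI ballI impI)
  show "counting_measure \<in> Def L MU \<rightarrow> carrier Q"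
  proof (rule funcsetI)
    fix X assume "X \<in> Def L MU"
    then obtain n where "X \<in> definable L MU n" unfolding Def_def by (rule UN_E)
    then obtain A where A: "A \<in> tuples n" "X = internal_set n A" using definable_internal by blast
    show "counting_measure X \<in> carrier Q"
      unfolding A(2) counting_measure_internal_set[OF A(1)] by (simp add: carrier_order_quotient)
  qed
next
  fix X assume "X \<in> Def L MU" "finite X"
  then show "counting_measure X = [card X] \<cdot>\<^bsub>Q\<^esub> \<one>\<^bsub>Q\<^esub>" by (rule counting_measure_finite)
next
  fix n X Y assume X: "X \<in> definable L MU n" and Y: "Y \<in> definable L MU n" and "X \<inter> Y = {}"
  then show "counting_measure (X \<union> Y) = counting_measure X \<oplus>\<^bsub>Q\<^esub> counting_measure Y"
    using definable_internal[OF X] definable_internal[OF Y] counting_measure_Un by blast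
next
  fix n m \<phi> assume "formula_of_lang L (n + m) \<phi>"
  then show "finite ((\<lambda>b. counting_measure (solutions MU n \<phi> b)) ` nlists m (carrier MU))"
    using assms unfolding has_definable_level_sets_def by simp
next
  fix n m \<phi> f assume "formula_of_lang L (n + m) \<phi>"
  then show "{b \<in> nlists m (carrier MU). counting_measure (solutions MU n \<phi> b) = f} \<in> definable0 L MU m"
    using assms unfolding has_definable_level_sets_def by simp
next
  fix n k X Y p f
  assume X: "X \<in> definable L MU n" and Y: "Y \<in> definable L MU k" and p: "p \<in> X \<rightarrow> Y"
    and f: "f \<in> carrier Q"
    and *: "(\<lambda>x. x @ p x) ` X \<in> definable L MU (n + k) \<and> (\<forall>a\<in>Y. counting_measure {x \<in> X. p x = a} = f)"
  obtain A where A: "A \<in> tuples n" "X = internal_set n A" using definable_internal[OF X] by (rule bexE)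
  obtain B where B: "B \<in> tuples k" "Y = internal_set k B" using definable_internal[OF Y] by (rule bexE)
  obtain G where G: "G \<in> tuples (n + k)" "(\<lambda>x. x @ p x) ` X = internal_set (n + k) G"
    using definable_internal[OF conjunct1[OF *]] by (rule bexE)
  show "counting_measure X = f \<otimes>\<^bsub>Q\<^esub> counting_measure Y"
    unfolding A(2) B(2)
  proof (rule counting_measure_fibres[OF A(1) B(1) G(1)])
    show "p \<in> internal_set n A \<rightarrow> internal_set k B" using p A(2) B(2) by simp
    show "(\<lambda>x. x @ p x) ` internal_set n A = internal_set (n + k) G" using G(2) A(2) by simp
    show "counting_measure {x \<in> internal_set n A. p x = y} = f" if "y \<in> internal_set k B" for y
      using * that A(2) B(2) by simp
  qed (rule f)
qed

lemma counting_measure_solutions: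
  assumes "formula_of_lang L (n + m) \<phi>" "b \<in> nlists m (carrier MU)"
  shows "counting_measure (solutions MU n \<phi> b) =
    nf (leq_along U E) (\<lambda>i. real (card (solutions (M i) n \<phi> (coord i b))))"
  unfolding solutions_ultraproduct[OF assms] by (rule counting_measure_internal_set[OF solutions_in_tuples])

text \<open>By the theorem of Los, the formula of a cell \<open>\<pi>\<close> defines in the ultraproduct the parameters \<open>b\<close>
  whose coordinates lie in \<open>\<pi>\<close> along \<open>U\<close>. Since the cells are finite in number, each parameter belongs to one
  of them, and the hypothesis \<open>size\<close> fixes the measure there.\<close>

lemma definable_level_sets_of_partition:
  assumes C: "\<And>i. M i \<in> C" and \<phi>: "formula_of_lang L (n + m) \<phi>"
    and P: "finite P" "definable_partition L C m P"
    and h: "\<And>\<pi>. \<pi> \<in> P \<Longrightarrow> h \<pi> \<in> nonneg_along U"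
    and size: "\<And>\<pi> b. \<lbrakk>\<pi> \<in> P; \<And>i. b i \<in> nlists m (carrier (M i)); \<forall>\<^sub>F i in U. (M i, b i) \<in> \<pi>\<rbrakk> \<Longrightarrow>
      equivalent (\<lambda>i. real (card (solutions (M i) n \<phi> (b i)))) (h \<pi>)"
  shows "finite ((\<lambda>b. counting_measure (solutions MU n \<phi> b)) ` nlists m (carrier MU))"
    and "{b \<in> nlists m (carrier MU). counting_measure (solutions MU n \<phi> b) = f} \<in> definable0 L MU m"
proof -
  obtain F where F': "\<forall>\<pi>\<in>P. formula_of_lang L m (F \<pi>) \<and>
      (\<forall>N\<in>C. solutions N m (F \<pi>) [] = {b \<in> nlists m (carrier N). (N, b) \<in> \<pi>})"
    using bchoice[OF P(2)[unfolded definable_partition_def, THEN conjunct2]] by (rule exE)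
  then have F: "formula_of_lang L m (F \<pi>)" if "\<pi> \<in> P" for \<pi> using that by blast
  have sol: "solutions N m (F \<pi>) [] = {b \<in> nlists m (carrier N). (N, b) \<in> \<pi>}"
    if "\<pi> \<in> P" "N \<in> C" for \<pi> N using F' that by blast
  have sol_MU: "b \<in> solutions MU m (F \<pi>) [] \<longleftrightarrow>
      b \<in> nlists m (carrier MU) \<and> (\<forall>\<^sub>F i in U. (M i, coord i b) \<in> \<pi>)" if "\<pi> \<in> P" for \<pi> b
  proof -
    have "solutions MU m (F \<pi>) [] = internal_set m (\<lambda>i. solutions (M i) m (F \<pi>) (coord i []))"
      by (rule solutions_ultraproduct[of m 0]) (simp_all add: F[OF that])
    then show ?thesis by (simp add: internal_set_def sol[OF that C] coord_in cong: conj_cong)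
  qed
  have measure_eq: "counting_measure (solutions MU n \<phi> b) = nf (leq_along U E) (h \<pi>)"
    if "\<pi> \<in> P" "b \<in> solutions MU m (F \<pi>) []" for \<pi> b
  proof -
    have b: "b \<in> nlists m (carrier MU)" "\<forall>\<^sub>F i in U. (M i, coord i b) \<in> \<pi>"
      using that sol_MU by blast+
    show ?thesis
      unfolding counting_measure_solutions[OF \<phi> b(1)]
      by (rule nf_eqI[OF real_sequence_nonneg h[OF that(1)] size[OF that(1) coord_in[OF b(1)] b(2)]])
  qed
  have \<Phi>: "finite (F ` P)" "\<And>\<psi>. \<psi> \<in> F ` P \<Longrightarrow> formula_of_lang L m \<psi>"
    using P(1) F by auto
  have cover: "\<exists>\<psi>\<in>F ` P. b \<in> solutions MU m \<psi> []" if b: "b \<in> nlists m (carrier MU)" for b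
  proof -
    have "\<Union>P = pointed C m" using P(2) by (simp add: definable_partition_def partition_on_def)
    moreover have "(M i, coord i b) \<in> pointed C m" for i
      using C coord_in[OF b] by (simp add: pointed_def)
    ultimately have "\<forall>\<^sub>F i in U. \<exists>\<pi>\<in>P. (M i, coord i b) \<in> \<pi>" by (intro always_eventually) blast
    from eventually_Bex_finite[OF P(1) this] obtain \<pi> where "\<pi> \<in> P" "\<forall>\<^sub>F i in U. (M i, coord i b) \<in> \<pi>"
      by (rule bexE)
    then show ?thesis using b by (intro bexI[of _ "F \<pi>"]) (simp_all add: sol_MU)
  qed
  have const: "counting_measure (solutions MU n \<phi> b) = counting_measure (solutions MU n \<phi> b')"
    if \<psi>: "\<psi> \<in> F ` P" and b: "b \<in> solutions MU m \<psi> []" "b' \<in> solutions MU m \<psi> []" for \<psi> b b'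
  proof -
    obtain \<pi> where \<pi>: "\<psi> = F \<pi>" "\<pi> \<in> P" using \<psi> by (rule imageE)
    show ?thesis
      using measure_eq[OF \<pi>(2) b(1)[unfolded \<pi>(1)]] measure_eq[OF \<pi>(2) b(2)[unfolded \<pi>(1)]] by simp
  qed
  show "finite ((\<lambda>b. counting_measure (solutions MU n \<phi> b)) ` nlists m (carrier MU))"
    by (rule definable_level_sets(1)[OF \<Phi> cover const])
  show "{b \<in> nlists m (carrier MU). counting_measure (solutions MU n \<phi> b) = f} \<in> definable0 L MU m"
    by (rule definable_level_sets(2)[where g = "\<lambda>b. counting_measure (solutions MU n \<phi> b)", OF \<Phi> cover const])
qed

end

section \<open>Asymptotic and exact classes\<close>

lemma pseudofinite_countingI:
  assumes "ultrafilter U" "\<And>i. M i \<in> C" "finite_structures L C" "tolerance U E"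
  shows "pseudofinite_counting L U M E"
proof -
  interpret tolerance U E by fact
  show ?thesis
    by unfold_locales (use assms in \<open>auto simp: finite_structures_def\<close>)
qed

text \<open>The estimates of an asymptotic class hold only from some size of the structure on, so a finite
  ultraproduct has to be treated by counting quantifiers instead.\<close>

lemma mac_level_sets:
  assumes U: "ultrafilter U" and C: "\<And>i. M i \<in> C" and mac: "mac L C"
  shows "pseudofinite_counting.has_definable_level_sets L U M {0<..}"
proof -
  interpret pseudofinite_counting L U M "{0<..}"
    using mac by (intro pseudofinite_countingI[OF U C] tolerance_positive[OF U]) (simp add: mac_def)
  show ?thesis unfolding has_definable_level_sets_def
  proof (intro allI impI)
    fix n m \<phi> assume \<phi>: "formula_of_lang L (n + m) \<phi>"
    show "finite ((\<lambda>b. counting_measure (solutions MU n \<phi> b)) ` nlists m (carrier MU)) \<and>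
      (\<forall>f. {b \<in> nlists m (carrier MU). counting_measure (solutions MU n \<phi> b) = f} \<in> definable0 L MU m)"
    proof (cases "finite (carrier MU)")
      case True
      have g: "counting_measure (solutions MU n \<phi> b) = [card (solutions MU n \<phi> b)] \<cdot>\<^bsub>Q\<^esub> \<one>\<^bsub>Q\<^esub>"
        if "b \<in> nlists m (carrier MU)" for b
      proof (rule counting_measure_finite[OF _ finite_solutions[OF True]])
        show "solutions MU n \<phi> b \<in> Def L MU" unfolding Def_def definable_def using \<phi> that by blast
      qed
      have const: "counting_measure (solutions MU n \<phi> b) = counting_measure (solutions MU n \<phi> b')"
        if "b \<in> nlists m (carrier MU)" "b' \<in> nlists m (carrier MU)"
          "card (solutions MU n \<phi> b) = card (solutions MU n \<phi> b')" for b b'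
        unfolding g[OF that(1)] g[OF that(2)] that(3) ..
      note level_sets = definable_level_sets_finite[OF True \<phi>,
          where g = "\<lambda>b. counting_measure (solutions MU n \<phi> b)", OF const]
      show ?thesis by (rule conjI[OF level_sets(1) allI[OF level_sets(2)]])
    next
      case False
      obtain P h where P: "finite P" "definable_partition L C m P"
        and h: "\<forall>\<pi>\<in>P. \<forall>N\<in>C. 0 \<le> h \<pi> N"
        and approx: "\<forall>\<pi>\<in>P. \<forall>\<epsilon>>0. \<exists>q. \<forall>(N, b)\<in>\<pi>. q < card (carrier N) \<longrightarrow>
            \<bar>real (card (solutions N n \<phi> b)) - h \<pi> N\<bar> \<le> \<epsilon> * h \<pi> N"
        using mac[unfolded mac_def, THEN conjunct2, THEN spec, THEN spec, THEN spec, THEN mp, OF \<phi>]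
        by (elim exE conjE) (rule that)
      have size: "equivalent (\<lambda>i. real (card (solutions (M i) n \<phi> (b i)))) (\<lambda>i. h \<pi> (M i))"
        if \<pi>: "\<pi> \<in> P" and b: "\<forall>\<^sub>F i in U. (M i, b i) \<in> \<pi>" for \<pi> b
      proof -
        have close: "\<forall>\<^sub>F i in U. \<bar>real (card (solutions (M i) n \<phi> (b i))) - h \<pi> (M i)\<bar> \<le> \<epsilon> * h \<pi> (M i)"
          if pos: "0 < \<epsilon>" for \<epsilon>
        proof -
          obtain q where q: "\<forall>(N, b)\<in>\<pi>. q < card (carrier N) \<longrightarrow>
            \<bar>real (card (solutions N n \<phi> b)) - h \<pi> N\<bar> \<le> \<epsilon> * h \<pi> N"
            using approx[rule_format, OF \<pi> pos] by (rule exE)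
          from b eventually_card_carrier_gt[OF False finite_carrier, of q] show ?thesis
            by eventually_elim (use q in blast)
        qed
        show ?thesis unfolding equivalent_def leq_along_def
        proof (intro conjI ballI)
          fix \<epsilon> :: real assume "\<epsilon> \<in> {0<..}"
          then have \<epsilon>: "0 < \<epsilon>" by simp
          from close[OF \<epsilon>]
          show "\<forall>\<^sub>F i in U. real (card (solutions (M i) n \<phi> (b i))) \<le> (1 + \<epsilon>) * h \<pi> (M i)"
            by eventually_elim (simp add: algebra_simps)
          \<comment> \<open>this error is chosen such that \<open>1 - \<epsilon> / (1 + \<epsilon>) = 1 / (1 + \<epsilon>)\<close>\<close>
          have "0 < \<epsilon> / (1 + \<epsilon>)" using \<epsilon> by simp
          from close[OF this]
          show "\<forall>\<^sub>F i in U. h \<pi> (M i) \<le> (1 + \<epsilon>) * real (card (solutions (M i) n \<phi> (b i)))"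
          proof eventually_elim
            case (elim i)
            let ?c = "real (card (solutions (M i) n \<phi> (b i)))"
            have "h \<pi> (M i) - ?c \<le> \<epsilon> / (1 + \<epsilon>) * h \<pi> (M i)" using elim by simp
            then have "(1 + \<epsilon>) * (h \<pi> (M i) - ?c) \<le> (1 + \<epsilon>) * (\<epsilon> / (1 + \<epsilon>) * h \<pi> (M i))"
              using \<epsilon> by (intro mult_left_mono) auto
            also have "\<dots> = \<epsilon> * h \<pi> (M i)" using \<epsilon> by simp
            finally show ?case by (simp add: algebra_simps)
          qed
        qed
      qed
      have "(\<lambda>i. h \<pi> (M i)) \<in> nonneg_along U" if "\<pi> \<in> P" for \<pi>
        using h[rule_format, OF that C] by (simp add: nonneg_along_def)
      note level_sets = definable_level_sets_of_partition[where h = "\<lambda>\<pi> i. h \<pi> (M i)", OF C \<phi> P this size]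
      show ?thesis by (rule conjI[OF level_sets(1) allI[OF level_sets(2)]])
    qed
  qed
qed

text \<open>On a cell the sizes agree along \<open>U\<close> with the values of \<open>h\<close>, which is equivalence for the
  relative error 0.\<close>

lemma mec_level_sets:
  assumes U: "ultrafilter U" and C: "\<And>i. M i \<in> C" and mec: "mec L C"
  shows "pseudofinite_counting.has_definable_level_sets L U M {0}"
proof -
  interpret pseudofinite_counting L U M "{0}"
    using mec by (intro pseudofinite_countingI[OF U C] tolerance_zero[OF U]) (simp add: mec_def)
  show ?thesis unfolding has_definable_level_sets_def
  proof (intro allI impI)
    fix n m \<phi> assume \<phi>: "formula_of_lang L (n + m) \<phi>"
    obtain P h where P: "finite P" "definable_partition L C m P"
      and h: "\<forall>\<pi>\<in>P. \<forall>N\<in>C. 0 \<le> h \<pi> N"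
      and exact: "\<forall>\<pi>\<in>P. \<forall>(N, b)\<in>\<pi>. real (card (solutions N n \<phi> b)) = h \<pi> N"
      using mec[unfolded mec_def, THEN conjunct2, THEN spec, THEN spec, THEN spec, THEN mp, OF \<phi>]
      by (elim exE conjE) (rule that)
    have size: "equivalent (\<lambda>i. real (card (solutions (M i) n \<phi> (b i)))) (\<lambda>i. h \<pi> (M i))"
      if \<pi>: "\<pi> \<in> P" and b: "\<forall>\<^sub>F i in U. (M i, b i) \<in> \<pi>" for \<pi> b
    proof -
      have "\<forall>\<^sub>F i in U. real (card (solutions (M i) n \<phi> (b i))) = h \<pi> (M i)"
        using b by eventually_elim (use exact \<pi> in blast)
      then show ?thesis
        unfolding equivalent_def leq_along_zero by (auto elim: eventually_mono)
    qed
    have "(\<lambda>i. h \<pi> (M i)) \<in> nonneg_along U" if "\<pi> \<in> P" for \<pi>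
      using h[rule_format, OF that C] by (simp add: nonneg_along_def)
    note level_sets = definable_level_sets_of_partition[where h = "\<lambda>\<pi> i. h \<pi> (M i)", OF C \<phi> P this size]
    show "finite ((\<lambda>b. counting_measure (solutions MU n \<phi> b)) ` nlists m (carrier MU)) \<and>
      (\<forall>f. {b \<in> nlists m (carrier MU). counting_measure (solutions MU n \<phi> b) = f} \<in> definable0 L MU m)"
      by (rule conjI[OF level_sets(1) allI[OF level_sets(2)]])
  qed
qed

lemma measurable_in_ultraproduct:
  assumes "pseudofinite_counting L U M E" "pseudofinite_counting.has_definable_level_sets L U M E"
  shows "measurable_in L (order_quotient (nonneg_along U) (leq_along U E)) (ultraproduct U M)"
proof -
  interpret pseudofinite_counting L U M E by fact
  show ?thesis
    unfolding measurable_in_def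
    using measuring_semiring_along is_measure_counting_measure[OF assms(2)] by blast
qed

theorem theorem5:
  fixes L :: "('f, 'r) language"
    and C :: "('f, 'r, 'a) fo_structure set"
    and U :: "'i filter"
    and M :: "'i \<Rightarrow> ('f, 'r, 'a) fo_structure"
  assumes "ultrafilter U" and "\<And>i. M i \<in> C"
  shows "(mac L C \<longrightarrow> generalised_measurable L (ultraproduct U M)) \<and>
         (mec L C \<longrightarrow>
            ring_measurable L (ultraproduct U M) \<and>
            (\<exists>S :: ('i \<Rightarrow> 'a) set list set ring_expr ord_ring.
               domain S \<and> ordered_cring S \<and> measurable_in L (nonneg S) (ultraproduct U M)))"
proof (intro conjI impI)
  assume mac: "mac L C"
  have "pseudofinite_counting L U M {0<..}"
    using mac by (intro pseudofinite_countingI[OF assms] tolerance_positive[OF assms(1)]) (simp add: mac_def)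
  then show "generalised_measurable L (ultraproduct U M)"
    by (rule generalised_measurableI[OF measurable_in_ultraproduct[OF _ mac_level_sets[OF assms mac]]])
next
  assume mec: "mec L C"
  have "pseudofinite_counting L U M {0}"
    using mec by (intro pseudofinite_countingI[OF assms] tolerance_zero[OF assms(1)]) (simp add: mec_def)
  then have "measurable_in L (order_quotient (nonneg_along U) (leq_along U {0})) (ultraproduct U M)"
    by (rule measurable_in_ultraproduct[OF _ mec_level_sets[OF assms mec]])
  then show ring: "ring_measurable L (ultraproduct U M)"
    unfolding nonneg_ultrapower[OF assms(1), symmetric]
    by (rule ring_measurableI[OF ordered_cring_ultrapower[OF assms(1)]])
  then show "\<exists>S :: ('i \<Rightarrow> 'a) set list set ring_expr ord_ring.
      domain S \<and> ordered_cring S \<and> measurable_in L (nonneg S) (ultraproduct U M)"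
    unfolding ring_measurable_def measurable_in_def using domain_ordered_cring by blast
qed

end
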